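(* For every prime $p\geq 3$ and every $\lambda\in\{(0,1),(1,1),\ldots,(p-1,1)\}$, the endomorphism monoid $\mathrm{End}(G_{\lambda}^{(p)})$ of the JK-group $G_{\lambda}^{(p)}$ is commutative. The endomorphism monoid of $G_{(0,1)}^{(2)}$ is commutative as well. In particular, there exist nonabelian finite $p$-groups with commutative endomorphism monoid.
   Context: For a prime $p$ and $\lambda=(\lambda_1,\lambda_2)\in\{(1,0),(0,1),(1,1),\ldots,(p-1,1)\}$, the JK-group $G_{\lambda}^{(p)}$ is the group generated by $a_1,a_2,b_1,b_2$ subject to the relations stating that it is nilpotent of class (at most) $2$ (all commutators are central) together with $$a_1^p=[a_1,b_1],\quad a_2^p=[a_1,b_1^{\lambda_1}b_2^{\lambda_2}],\quad b_1^p=[a_2,b_1b_2],\quad b_2^p=[a_2,b_2],\quad [a_1,a_2]=[b_1,b_2]=1.$$ It is a $p$-group of order $p^8$. The monoid $\mathrm{End}(G)$ of a group $G$ consists of all endomorphisms of $G$ under composition. *)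

theory Defs
  imports "HOL-Algebra.Coset" "HOL-Computational_Algebra.Primes"
begin

text \<open>
  Group words over an alphabet \<^typ>\<open>'a\<close> are lists of letters; \<^term>\<open>(x, True)\<close> stands for
  the generator \<^term>\<open>x\<close> and \<^term>\<open>(x, False)\<close> for its formal inverse.
\<close>

type_synonym 'a gword = "('a \<times> bool) list"

definition gen_word :: "'a \<Rightarrow> 'a gword" where
  "gen_word x = [(x, True)]"

definition inv_word :: "'a gword \<Rightarrow> 'a gword" where
  "inv_word w = rev (map (\<lambda>(x, e). (x, \<not> e)) w)"

definition pow_word :: "'a gword \<Rightarrow> nat \<Rightarrow> 'a gword" where
  "pow_word w n = concat (replicate n w)"

definition comm_word :: "'a gword \<Rightarrow> 'a gword \<Rightarrow> 'a gword" where
  "comm_word u v = inv_word u @ inv_word v @ u @ v"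

text \<open>
  A relation \<open>l = r\<close> is a pair of words. \<open>pres_eq R u v\<close> says that \<open>u\<close> and \<open>v\<close> represent
  the same element of the group presented by the relations \<open>R\<close>.
\<close>

inductive pres_eq :: "('a gword \<times> 'a gword) set \<Rightarrow> 'a gword \<Rightarrow> 'a gword \<Rightarrow> bool"
  for R :: "('a gword \<times> 'a gword) set" where
  pres_refl: "pres_eq R u u"
| pres_sym: "pres_eq R u v \<Longrightarrow> pres_eq R v u"
| pres_trans: "pres_eq R u v \<Longrightarrow> pres_eq R v w \<Longrightarrow> pres_eq R u w"
| pres_cancel: "pres_eq R (u @ [(x, e), (x, \<not> e)] @ v) (u @ v)"
| pres_relation: "(l, r) \<in> R \<Longrightarrow> pres_eq R (u @ l @ v) (u @ r @ v)"

definition pres_class :: "('a gword \<times> 'a gword) set \<Rightarrow> 'a gword \<Rightarrow> 'a gword set" where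
  "pres_class R u = {v. pres_eq R u v}"

text \<open>The group generated by all letters of the alphabet subject to the relations \<open>R\<close>.\<close>

definition presented_group :: "('a gword \<times> 'a gword) set \<Rightarrow> 'a gword set monoid" where
  "presented_group R =
    \<lparr>carrier = range (pres_class R),
     monoid.mult = (\<lambda>X Y. \<Union>u\<in>X. \<Union>v\<in>Y. pres_class R (u @ v)),
     one = pres_class R []\<rparr>"

lemma pres_eq_append_left: "pres_eq R u v \<Longrightarrow> pres_eq R (w @ u) (w @ v)"
proof (induction rule: pres_eq.induct)
  case (pres_cancel u x e v)
  show ?case using pres_eq.pres_cancel[of R "w @ u" x e v] by simp
next
  case (pres_relation l r u v)
  then show ?case using pres_eq.pres_relation[of l r R "w @ u" v] by simp
next
  case (pres_trans u v w')
  show ?case by (rule pres_eq.pres_trans[OF pres_trans.IH])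
next
  case (pres_sym u v)
  show ?case by (rule pres_eq.pres_sym[OF pres_sym.IH])
qed (rule pres_eq.pres_refl)

lemma pres_eq_append_right: "pres_eq R u v \<Longrightarrow> pres_eq R (u @ w) (v @ w)"
proof (induction rule: pres_eq.induct)
  case (pres_cancel u x e v)
  show ?case using pres_eq.pres_cancel[of R u x e "v @ w"] by simp
next
  case (pres_relation l r u v)
  then show ?case using pres_eq.pres_relation[of l r R u "v @ w"] by simp
next
  case (pres_trans u v w')
  show ?case by (rule pres_eq.pres_trans[OF pres_trans.IH])
next
  case (pres_sym u v)
  show ?case by (rule pres_eq.pres_sym[OF pres_sym.IH])
qed (rule pres_eq.pres_refl)

lemma pres_eq_append:
  "pres_eq R u u' \<Longrightarrow> pres_eq R v v' \<Longrightarrow> pres_eq R (u @ v) (u' @ v')"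
  by (rule pres_eq.pres_trans[OF pres_eq_append_right pres_eq_append_left])

lemma pres_class_eq_iff: "pres_class R u = pres_class R v \<longleftrightarrow> pres_eq R u v"
proof
  assume "pres_class R u = pres_class R v"
  moreover have "v \<in> pres_class R v"
    by (simp add: pres_class_def pres_eq.pres_refl)
  ultimately have "v \<in> pres_class R u"
    by (simp only:)
  then show "pres_eq R u v"
    by (simp add: pres_class_def)
next
  assume uv: "pres_eq R u v"
  show "pres_class R u = pres_class R v"
    using pres_eq.pres_trans[OF uv] pres_eq.pres_trans[OF pres_eq.pres_sym[OF uv]]
    by (auto simp: pres_class_def)
qed

lemma pres_eq_inv_word_left: "pres_eq R (inv_word w @ w) []"
proof (induction w)
  case Nil
  show ?case by (simp add: inv_word_def pres_eq.pres_refl)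
next
  case (Cons a w)
  obtain x e where a: "a = (x, e)" by (cases a)
  have "pres_eq R (inv_word w @ [(x, \<not> e), (x, \<not> \<not> e)] @ w) (inv_word w @ w)"
    by (rule pres_eq.pres_cancel)
  then have "pres_eq R (inv_word (a # w) @ a # w) (inv_word w @ w)"
    by (simp add: a inv_word_def)
  then show ?case using Cons.IH by (rule pres_eq.pres_trans)
qed

lemma carrier_presented_group: "carrier (presented_group R) = range (pres_class R)"
  and one_presented_group: "\<one>\<^bsub>presented_group R\<^esub> = pres_class R []"
  by (simp_all add: presented_group_def)

lemma mult_presented_group:
  "pres_class R u \<otimes>\<^bsub>presented_group R\<^esub> pres_class R v = pres_class R (u @ v)"
proof -
  have "pres_class R (u' @ v') = pres_class R (u @ v)"
    if "u' \<in> pres_class R u" "v' \<in> pres_class R v" for u' v'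
  proof -
    have "pres_eq R (u @ v) (u' @ v')"
      using that by (simp add: pres_class_def pres_eq_append)
    then show ?thesis unfolding pres_class_eq_iff by (rule pres_eq.pres_sym)
  qed
  then have "(\<Union>u'\<in>pres_class R u. \<Union>v'\<in>pres_class R v. pres_class R (u' @ v'))
      = (\<Union>u'\<in>pres_class R u. \<Union>v'\<in>pres_class R v. pres_class R (u @ v))"
    by (intro SUP_cong refl)
  also have "\<dots> = pres_class R (u @ v)"
  proof -
    have "pres_class R u \<noteq> {}" "pres_class R v \<noteq> {}"
      by (auto simp: pres_class_def intro: pres_eq.pres_refl)
    then show ?thesis by (simp del: UN_simps)
  qed
  finally show ?thesis
    by (simp add: presented_group_def del: UN_simps)
qed

lemma group_presented_group: "group (presented_group R)"
proof (rule groupI)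
  fix X assume "X \<in> carrier (presented_group R)"
  then obtain w where X: "X = pres_class R w"
    by (auto simp: carrier_presented_group)
  have "pres_class R (inv_word w) \<otimes>\<^bsub>presented_group R\<^esub> X = \<one>\<^bsub>presented_group R\<^esub>"
    by (simp add: X mult_presented_group one_presented_group pres_class_eq_iff
        pres_eq_inv_word_left)
  then show "\<exists>Y\<in>carrier (presented_group R). Y \<otimes>\<^bsub>presented_group R\<^esub> X = \<one>\<^bsub>presented_group R\<^esub>"
    by (auto simp: carrier_presented_group)
qed (auto simp: carrier_presented_group one_presented_group mult_presented_group)

datatype jk_gen = A1 | A2 | B1 | B2

text \<open>
  The first set makes every commutator (of arbitrary elements, not only of generators) central.
  In a group of class at most 2 one has \<open>[x\<inverse>, y\<inverse>] = [x, y]\<close>, so the relations do not depend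
  on which of the usual conventions is chosen for commutators.
\<close>

definition jk_relations :: "nat \<Rightarrow> nat \<times> nat \<Rightarrow> (jk_gen gword \<times> jk_gen gword) set" where
  "jk_relations p l =
    (let a1 = gen_word A1; a2 = gen_word A2; b1 = gen_word B1; b2 = gen_word B2 in
      {(comm_word u v @ w, w @ comm_word u v) | u v w. True} \<union>
      {(pow_word a1 p, comm_word a1 b1),
       (pow_word a2 p, comm_word a1 (pow_word b1 (fst l) @ pow_word b2 (snd l))),
       (pow_word b1 p, comm_word a2 (b1 @ b2)),
       (pow_word b2 p, comm_word a2 b2),
       (comm_word a1 a2, []),
       (comm_word b1 b2, [])})"

definition JK_group :: "nat \<Rightarrow> nat \<times> nat \<Rightarrow> jk_gen gword set monoid" where
  "JK_group p l = presented_group (jk_relations p l)"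

text \<open>Endomorphisms are extensional, so that each is represented by exactly one function.\<close>

definition End_monoid :: "('a, 'b) monoid_scheme \<Rightarrow> ('a \<Rightarrow> 'a) monoid" where
  "End_monoid G =
    \<lparr>carrier = hom G G \<inter> extensional (carrier G),
     monoid.mult = compose (carrier G),
     one = (\<lambda>x\<in>carrier G. x)\<rparr>"

definition finite_p_group :: "nat \<Rightarrow> ('a, 'b) monoid_scheme \<Rightarrow> bool" where
  "finite_p_group p G \<longleftrightarrow> group G \<and> finite (carrier G) \<and> (\<exists>n. order G = p ^ n)"

end

theory Submission
  imports Defs
begin

text \<open>
  Collecting the generators writes every element of the JK-group as \<open>a\<^sub>1\<^bsup>n1\<^esup> a\<^sub>2\<^bsup>n2\<^esup> b\<^sub>1\<^bsup>n3\<^esup> b\<^sub>2\<^bsup>n4\<^esup> z\<close> with \<open>z\<close> a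
  product of powers of the four commutators \<open>[a\<^sub>i, b\<^sub>j]\<close>, and two such expressions agree exactly
  when they are congruent modulo the relations, so \<open>G/G'\<close> and \<open>G'\<close> are \<open>F\<^sub>p\<close>-spaces of dimension 4.
  An endomorphism induces a linear map of \<open>G/G' = A \<oplus> B\<close> compatible with the power map
  \<open>G/G' \<rightarrow> G' = A \<otimes> B\<close> and with the commutator map. Two commuting vectors are proportional, or
  both lie in \<open>A\<close>, or both lie in \<open>B\<close>; going through these cases for the images of the generators
  shows that the induced map is 0 or the identity. Hence every endomorphism has the form
  \<open>x \<mapsto> x\<^bsup>e\<^esup> \<zeta>(x)\<close> with \<open>e \<in> {0, 1}\<close> and \<open>\<zeta> : G/G' \<rightarrow> G'\<close> linear, and any two such maps commute.
\<close>

subsection \<open>Exponents of words\<close>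

definition letter_sign :: "bool \<Rightarrow> int" where
  "letter_sign e = (if e then 1 else - 1)"

definition unit_vec :: "jk_gen \<Rightarrow> jk_gen \<Rightarrow> int" where
  "unit_vec g x = (if x = g then 1 else 0)"

primrec expo :: "jk_gen gword \<Rightarrow> jk_gen \<Rightarrow> int" where
  "expo [] x = 0"
| "expo (a # w) x = letter_sign (snd a) * unit_vec (fst a) x + expo w x"

text \<open>
  For \<open>i \<in> {A1, A2}\<close> and \<open>j \<in> {B1, B2}\<close>, \<open>cexpo w i j\<close> is the exponent of \<open>[i, j]\<close> after collecting \<open>w\<close>
  with the \<open>a\<close>'s to the left: moving a letter \<open>j\<close> past \<open>i\<^bsup>n\<^esup>\<close> costs \<open>[i, j]\<^bsup>-n\<^esup>\<close>. Other index pairs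
  carry no information; allowing them keeps the arithmetic uniform.
\<close>

primrec cexpo :: "jk_gen gword \<Rightarrow> jk_gen \<Rightarrow> jk_gen \<Rightarrow> int" where
  "cexpo [] i j = 0"
| "cexpo (a # w) i j = cexpo w i j - letter_sign (snd a) * unit_vec (fst a) j * expo w i"

lemma expo_append: "expo (u @ v) x = expo u x + expo v x"
  by (induction u) auto

text \<open>To collect \<open>u @ v\<close>, the letters \<open>i\<close> of \<open>v\<close> must
  cross the letters \<open>j\<close> of \<open>u\<close>; each crossing contributes -1, counted with
  signs, to the exponent of \<open>[i, j]\<close>.\<close>

lemma cexpo_append: "cexpo (u @ v) i j = cexpo u i j + cexpo v i j - expo u j * expo v i"
  by (induction u) (auto simp: expo_append algebra_simps)

lemma inv_word_simps [simp]: "inv_word [] = []" "inv_word (a # w) = inv_word w @ [(fst a, \<not> snd a)]"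
  by (auto simp: inv_word_def split: prod.splits)

lemma letter_sign_not: "letter_sign (\<not> e) = - letter_sign e"
  by (simp add: letter_sign_def)

lemma expo_inv_word: "expo (inv_word w) x = - expo w x"
  by (induction w) (auto simp: expo_append letter_sign_not)

text \<open>Inverting reverses the collected order, and restoring it costs the product of the two
  exponents. For \<open>i = j\<close> a single letter already violates the formula.\<close>

lemma cexpo_inv_word:
  assumes "i \<noteq> j"
  shows "cexpo (inv_word w) i j = - cexpo w i j - expo w i * expo w j"
  using assms
  by (induction w)
    (auto simp: cexpo_append expo_append expo_inv_word letter_sign_not unit_vec_def algebra_simps)

lemma expo_comm_word: "expo (comm_word u v) x = 0"
  by (simp add: comm_word_def expo_append expo_inv_word)

text \<open>The commutator map of a class-two group is bilinear and alternating on
  \<open>G/G'\<close>, so only the exponent vectors of \<open>u\<close> and \<open>v\<close>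
  enter.\<close>

lemma cexpo_comm_word:
  assumes "i \<noteq> j"
  shows "cexpo (comm_word u v) i j = expo u i * expo v j - expo v i * expo u j"
  using assms by (simp add: comm_word_def cexpo_append expo_append expo_inv_word cexpo_inv_word algebra_simps)

lemma pow_word_simps [simp]: "pow_word w 0 = []" "pow_word w (Suc n) = w @ pow_word w n"
  by (simp_all add: pow_word_def)

lemma expo_pow_word: "expo (pow_word w n) x = int n * expo w x"
  by (induction n) (auto simp: expo_append algebra_simps)

text \<open>Each of the \<open>n choose 2\<close> pairs of copies of \<open>w\<close> contributes
  one crossing term.\<close>

lemma cexpo_pow_word:
  "cexpo (pow_word w n) i j = int n * cexpo w i j - int (n choose 2) * expo w i * expo w j"
  by (induction n)
    (auto simp: cexpo_append expo_pow_word numeral_2_eq_2 algebra_simps)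

lemma expo_gen_word: "expo (gen_word g) = unit_vec g" "cexpo (gen_word g) i j = 0"
  by (auto simp: gen_word_def letter_sign_def)

text \<open>
  \<open>power_map l n\<close> is the coordinate matrix in \<open>A \<otimes> B\<close> of the \<open>p\<close>-th power of an element with exponent
  vector \<open>n\<close>, read off from the four power relations with \<open>\<lambda> = (l, 1)\<close> (exactly for odd \<open>p\<close>;
  for \<open>p = 2\<close> up to the quadratic correction in \<open>power_form\<close> below).
\<close>

definition power_map :: "int \<Rightarrow> (jk_gen \<Rightarrow> int) \<Rightarrow> jk_gen \<Rightarrow> jk_gen \<Rightarrow> int" where
  "power_map l n i j =
    (if i = A1 then (if j = B1 then n A1 + l * n A2 else n A2)
     else (if j = B1 then n B1 else n B1 + n B2))"

lemma power_map_linear: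
  "power_map l (\<lambda>x. a * n x + b * n' x) i j = a * power_map l n i j + b * power_map l n' i j"
  by (simp add: power_map_def algebra_simps)

lemma power_map_zero: "power_map l (\<lambda>x. 0) i j = 0"
  by (simp add: power_map_def)

section \<open>Congruence of exponents modulo the power relations\<close>

text \<open>
  \<open>(n, m)\<close> and \<open>(n', m')\<close> are exponents of the same element of the JK-group: a factor \<open>h\<^bsup>p k\<^esup>\<close>
  may be traded for the central element given by the power relations.
\<close>

definition jk_equiv :: "int \<Rightarrow> int \<Rightarrow> (jk_gen \<Rightarrow> int) \<Rightarrow> (jk_gen \<Rightarrow> jk_gen \<Rightarrow> int) \<Rightarrow>
    (jk_gen \<Rightarrow> int) \<Rightarrow> (jk_gen \<Rightarrow> jk_gen \<Rightarrow> int) \<Rightarrow> bool" where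
  "jk_equiv p l n m n' m' \<longleftrightarrow>
    (\<exists>k. (\<forall>x. n' x = n x + p * k x) \<and>
      (\<forall>i\<in>{A1, A2}. \<forall>j\<in>{B1, B2}. p dvd m' i j - m i j + power_map l k i j))"

lemma jk_equivI:
  assumes "\<And>x. n' x = n x + p * k x"
    and "\<And>i j. i \<in> {A1, A2} \<Longrightarrow> j \<in> {B1, B2} \<Longrightarrow> p dvd m' i j - m i j + power_map l k i j"
  shows "jk_equiv p l n m n' m'"
  using assms unfolding jk_equiv_def by blast

lemma jk_equivE:
  assumes "jk_equiv p l n m n' m'"
  obtains k where "\<And>x. n' x = n x + p * k x"
    and "\<And>i j. i \<in> {A1, A2} \<Longrightarrow> j \<in> {B1, B2} \<Longrightarrow> p dvd m' i j - m i j + power_map l k i j"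
  using assms unfolding jk_equiv_def by blast

lemma jk_equiv_refl: "jk_equiv p l n m n m"
  by (rule jk_equivI[where k = "\<lambda>_. 0"]) (auto simp: power_map_def)

lemma jk_equiv_sym:
  assumes "jk_equiv p l n m n' m'"
  shows "jk_equiv p l n' m' n m"
proof -
  obtain k where k: "\<And>x. n' x = n x + p * k x"
    "\<And>i j. i \<in> {A1, A2} \<Longrightarrow> j \<in> {B1, B2} \<Longrightarrow> p dvd m' i j - m i j + power_map l k i j"
    using assms by (rule jk_equivE) blast
  show ?thesis
  proof (rule jk_equivI[where k = "\<lambda>x. - k x"])
    fix i j assume "i \<in> {A1, A2}" "j \<in> {B1, B2}"
    moreover have "m i j - m' i j + power_map l (\<lambda>x. - k x) i j
        = - (m' i j - m i j + power_map l k i j)"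
      by (simp add: power_map_def)
    ultimately show "p dvd m i j - m' i j + power_map l (\<lambda>x. - k x) i j"
      using k(2) by (simp only: dvd_minus_iff)
  qed (simp add: k(1))
qed

lemma jk_equiv_trans:
  assumes "jk_equiv p l n m n' m'" "jk_equiv p l n' m' n'' m''"
  shows "jk_equiv p l n m n'' m''"
proof -
  obtain k where k: "\<And>x. n' x = n x + p * k x"
    "\<And>i j. i \<in> {A1, A2} \<Longrightarrow> j \<in> {B1, B2} \<Longrightarrow> p dvd m' i j - m i j + power_map l k i j"
    using assms(1) by (rule jk_equivE) blast
  obtain k' where k': "\<And>x. n'' x = n' x + p * k' x"
    "\<And>i j. i \<in> {A1, A2} \<Longrightarrow> j \<in> {B1, B2} \<Longrightarrow> p dvd m'' i j - m' i j + power_map l k' i j"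
    using assms(2) by (rule jk_equivE) blast
  show ?thesis
  proof (rule jk_equivI[where k = "\<lambda>x. k x + k' x"])
    fix i j assume ij: "i \<in> {A1, A2}" "j \<in> {B1, B2}"
    have "m'' i j - m i j + power_map l (\<lambda>x. k x + k' x) i j
        = (m' i j - m i j + power_map l k i j) + (m'' i j - m' i j + power_map l k' i j)"
      by (simp add: power_map_def algebra_simps)
    then show "p dvd m'' i j - m i j + power_map l (\<lambda>x. k x + k' x) i j"
      using k(2)[OF ij] k'(2)[OF ij] by (simp only: dvd_add)
  qed (simp add: k(1) k'(1) algebra_simps)
qed

text \<open>The product on exponents is that of \<open>cexpo_append\<close>. Shifting exponents by
  multiples of \<open>p\<close> changes the crossing term only by multiples of \<open>p\<close>, and
  the shifts themselves add because \<open>power_map\<close> is linear.\<close>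

lemma jk_equiv_mult:
  assumes "jk_equiv p l n m n1 m1" "jk_equiv p l n' m' n1' m1'"
  shows "jk_equiv p l (\<lambda>x. n x + n' x) (\<lambda>i j. m i j + m' i j - n j * n' i)
    (\<lambda>x. n1 x + n1' x) (\<lambda>i j. m1 i j + m1' i j - n1 j * n1' i)"
proof -
  obtain k where k: "\<And>x. n1 x = n x + p * k x"
    "\<And>i j. i \<in> {A1, A2} \<Longrightarrow> j \<in> {B1, B2} \<Longrightarrow> p dvd m1 i j - m i j + power_map l k i j"
    using assms(1) by (rule jk_equivE) blast
  obtain k' where k': "\<And>x. n1' x = n' x + p * k' x"
    "\<And>i j. i \<in> {A1, A2} \<Longrightarrow> j \<in> {B1, B2} \<Longrightarrow> p dvd m1' i j - m' i j + power_map l k' i j"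
    using assms(2) by (rule jk_equivE) blast
  show ?thesis
  proof (rule jk_equivI[where k = "\<lambda>x. k x + k' x"])
    fix i j assume ij: "i \<in> {A1, A2}" "j \<in> {B1, B2}"
    have "m1 i j + m1' i j - n1 j * n1' i - (m i j + m' i j - n j * n' i)
          + power_map l (\<lambda>x. k x + k' x) i j
        = (m1 i j - m i j + power_map l k i j) + (m1' i j - m' i j + power_map l k' i j)
          + p * (- k j * n' i - n j * k' i - p * k j * k' i)"
      by (simp add: power_map_def k(1) k'(1) algebra_simps)
    then show "p dvd m1 i j + m1' i j - n1 j * n1' i - (m i j + m' i j - n j * n' i)
          + power_map l (\<lambda>x. k x + k' x) i j"
      using k(2)[OF ij] k'(2)[OF ij] by (simp only: dvd_add dvd_triv_left)
  qed (simp add: k(1) k'(1) algebra_simps)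
qed

text \<open>The same argument for the inversion formula of \<open>cexpo_inv_word\<close>.\<close>

lemma jk_equiv_inv:
  assumes "jk_equiv p l n m n' m'"
  shows "jk_equiv p l (\<lambda>x. - n x) (\<lambda>i j. - m i j - n i * n j)
    (\<lambda>x. - n' x) (\<lambda>i j. - m' i j - n' i * n' j)"
proof -
  obtain k where k: "\<And>x. n' x = n x + p * k x"
    "\<And>i j. i \<in> {A1, A2} \<Longrightarrow> j \<in> {B1, B2} \<Longrightarrow> p dvd m' i j - m i j + power_map l k i j"
    using assms by (rule jk_equivE) blast
  show ?thesis
  proof (rule jk_equivI[where k = "\<lambda>x. - k x"])
    fix i j assume ij: "i \<in> {A1, A2}" "j \<in> {B1, B2}"
    have "- m' i j - n' i * n' j - (- m i j - n i * n j) + power_map l (\<lambda>x. - k x) i j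
        = - (m' i j - m i j + power_map l k i j)
          + p * (- k i * n j - n i * k j - p * k i * k j)"
      by (simp add: power_map_def k(1) algebra_simps)
    then show "p dvd - m' i j - n' i * n' j - (- m i j - n i * n j) + power_map l (\<lambda>x. - k x) i j"
      using k(2)[OF ij] by (simp only: dvd_add dvd_triv_left dvd_minus_iff)
  qed (simp add: k(1) algebra_simps)
qed

text \<open>An arithmetic counterpart of \<open>pres_eq\<close>;
  \<open>pres_eq_iff_word_equiv\<close> shows that the two coincide.\<close>

definition word_equiv :: "nat \<Rightarrow> nat \<Rightarrow> jk_gen gword \<Rightarrow> jk_gen gword \<Rightarrow> bool" where
  "word_equiv p l u v \<longleftrightarrow> jk_equiv (int p) (int l) (expo u) (cexpo u) (expo v) (cexpo v)"

lemma word_equivI: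
  assumes "\<And>x. expo u x = expo v x"
    and "\<And>i j. i \<in> {A1, A2} \<Longrightarrow> j \<in> {B1, B2} \<Longrightarrow> cexpo u i j = cexpo v i j"
  shows "word_equiv p l u v"
  unfolding word_equiv_def
  by (rule jk_equivI[where k = "\<lambda>x. 0"]) (auto simp: assms power_map_def)

lemma word_equiv_append:
  assumes "word_equiv p l u u'" "word_equiv p l v v'"
  shows "word_equiv p l (u @ v) (u' @ v')"
proof -
  have "expo (u @ v) = (\<lambda>x. expo u x + expo v x)"
    "cexpo (u @ v) = (\<lambda>i j. cexpo u i j + cexpo v i j - expo u j * expo v i)" for u v
    by (auto simp: fun_eq_iff expo_append cexpo_append)
  with jk_equiv_mult assms show ?thesis
    unfolding word_equiv_def by simp
qed

lemma word_equiv_relation: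
  assumes "(u, v) \<in> jk_relations p (l, 1)" "p > 0"
  shows "word_equiv p l u v"
proof -
  have *: "word_equiv p l (pow_word (gen_word g) p) v"
    if "\<And>x. expo v x = 0"
      "\<And>i j. i \<in> {A1, A2} \<Longrightarrow> j \<in> {B1, B2} \<Longrightarrow> cexpo v i j = power_map (int l) (unit_vec g) i j"
    for g v
    unfolding word_equiv_def
    \<comment> \<open>The exponent \<open>p\<close> of \<open>g\<close> is removed and paid for with
      the central element of its power relation.\<close>
    by (rule jk_equivI[where k = "\<lambda>x. - unit_vec g x"])
      (auto simp: that expo_pow_word cexpo_pow_word expo_gen_word power_map_def unit_vec_def)
  note simps = expo_append cexpo_append expo_comm_word cexpo_comm_word expo_pow_word
    cexpo_pow_word expo_gen_word power_map_def unit_vec_def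
  from assms(1) consider u' v' w where "u = comm_word u' v' @ w" "v = w @ comm_word u' v'"
    | "u = pow_word (gen_word A1) p" "v = comm_word (gen_word A1) (gen_word B1)"
    | "u = pow_word (gen_word A2) p"
      "v = comm_word (gen_word A1) (pow_word (gen_word B1) l @ pow_word (gen_word B2) 1)"
    | "u = pow_word (gen_word B1) p" "v = comm_word (gen_word A2) (gen_word B1 @ gen_word B2)"
    | "u = pow_word (gen_word B2) p" "v = comm_word (gen_word A2) (gen_word B2)"
    | "u = comm_word (gen_word A1) (gen_word A2)" "v = []"
    | "u = comm_word (gen_word B1) (gen_word B2)" "v = []"
    unfolding jk_relations_def Let_def by auto
  then show ?thesis
  proof cases
    case 1
    then show ?thesis by (auto intro!: word_equivI simp: simps)
  next
    case 2
    show ?thesis unfolding 2 by (rule *) (auto simp: simps)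
  next
    case 3
    show ?thesis unfolding 3 by (rule *) (auto simp: simps)
  next
    case 4
    show ?thesis unfolding 4 by (rule *) (auto simp: simps)
  next
    case 5
    show ?thesis unfolding 5 by (rule *) (auto simp: simps)
  next
    case 6
    then show ?thesis by (auto intro!: word_equivI simp: simps)
  next
    case 7
    then show ?thesis by (auto intro!: word_equivI simp: simps)
  qed
qed

text \<open>Exponents modulo the congruence are invariants of group elements:
  \<open>word_equiv\<close> is a congruence on words that contains every defining relation. This is
  what keeps the presented group from collapsing.\<close>

lemma pres_eq_imp_word_equiv:
  assumes "pres_eq (jk_relations p (l, 1)) u v" "p > 0"
  shows "word_equiv p l u v"
  using assms(1)
proof (induction rule: pres_eq.induct)
  case (pres_refl u)
  then show ?case by (simp add: word_equiv_def jk_equiv_refl)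
next
  case (pres_sym u v)
  then show ?case by (simp add: word_equiv_def jk_equiv_sym)
next
  case (pres_trans u v w)
  then show ?case unfolding word_equiv_def by (blast intro: jk_equiv_trans)
next
  case (pres_cancel u x e v)
  show ?case
    by (rule word_equivI)
      (auto simp: expo_append cexpo_append letter_sign_not unit_vec_def)
next
  case (pres_relation l' r u v)
  then show ?case
    using assms(2) word_equiv_relation[of l' r p l]
    by (intro word_equiv_append) (auto simp: word_equiv_def jk_equiv_refl)
qed

subsection \<open>Linear algebra modulo a prime\<close>

text \<open>Vectors over the field with \<open>p\<close> elements are integer functions, and
  vanishing is divisibility by \<open>p\<close>, so that congruences can be solved by
  \<open>algebra\<close>. \<open>A\<close> and \<open>B\<close> below are the spans of
  \<open>A1\<close>, \<open>A2\<close> and of \<open>B1\<close>, \<open>B2\<close>.\<close>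

definition vec_zero :: "int \<Rightarrow> (jk_gen \<Rightarrow> int) \<Rightarrow> bool" where
  "vec_zero p v \<longleftrightarrow> (\<forall>x. p dvd v x)"

definition tensor_zero :: "int \<Rightarrow> (jk_gen \<Rightarrow> jk_gen \<Rightarrow> int) \<Rightarrow> bool" where
  "tensor_zero p m \<longleftrightarrow> (\<forall>i\<in>{A1, A2}. \<forall>j\<in>{B1, B2}. p dvd m i j)"

text \<open>The commutator map from \<open>G/G'\<close> to \<open>G'\<close> in coordinates; compare
  \<open>cexpo_comm_word\<close>.\<close>

definition wedge :: "(jk_gen \<Rightarrow> int) \<Rightarrow> (jk_gen \<Rightarrow> int) \<Rightarrow> jk_gen \<Rightarrow> jk_gen \<Rightarrow> int" where
  "wedge v w i j = v i * w j - w i * v j"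

lemma vec_zero_iff: "vec_zero p v \<longleftrightarrow> p dvd v A1 \<and> p dvd v A2 \<and> p dvd v B1 \<and> p dvd v B2"
  unfolding vec_zero_def by (metis jk_gen.exhaust)

lemma tensor_zero_iff:
  "tensor_zero p m \<longleftrightarrow> p dvd m A1 B1 \<and> p dvd m A1 B2 \<and> p dvd m A2 B1 \<and> p dvd m A2 B2"
  by (auto simp: tensor_zero_def)

text \<open>The hypothesis equates two rank-one matrices: the \<open>A\<close>-part of
  \<open>v\<close> times the \<open>B\<close>-part of \<open>w\<close>, and the same with
  \<open>v\<close> and \<open>w\<close> exchanged. If the \<open>A\<close>-part of \<open>v\<close>
  vanishes, so does that of \<open>w\<close> or the \<open>B\<close>-part of \<open>v\<close>.
  Otherwise the \<open>B\<close>-part of \<open>w\<close> is a multiple of that of \<open>v\<close>,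
  and the factor carries over to the \<open>A\<close>-parts unless the \<open>B\<close>-parts
  vanish.\<close>

lemma wedge_zero_cases:
  assumes p: "prime (p::int)" and wedge: "tensor_zero p (wedge v w)"
  shows "vec_zero p v \<or> (\<exists>c. vec_zero p (\<lambda>x. w x - c * v x)) \<or>
    (\<forall>x\<in>{B1, B2}. p dvd v x \<and> p dvd w x) \<or> (\<forall>x\<in>{A1, A2}. p dvd v x \<and> p dvd w x)"
proof (cases "p dvd v A1 \<and> p dvd v A2")
  case True
  have "p dvd w i" if "i \<in> {A1, A2}" "j \<in> {B1, B2}" "\<not> p dvd v j" for i j
  proof -
    have "p dvd v i" "p dvd v i * w j - w i * v j"
      using True wedge that unfolding tensor_zero_def wedge_def by auto
    then have "p dvd w i * v j" by algebra
    then show ?thesis using p that by (simp add: prime_dvd_mult_iff)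
  qed
  then show ?thesis
    using True by (auto simp: vec_zero_iff)
next
  case False
  then obtain i where i: "i \<in> {A1, A2}" "\<not> p dvd v i" by auto
  then have "coprime (v i) p"
    using p by (metis coprime_commute prime_imp_coprime)
  then obtain a b where "a * v i + b * p = 1"
    by (metis bezout_int coprime_iff_gcd_eq_1)
  then have a: "p dvd v i * a - 1" by algebra
  \<comment> \<open>\<open>a\<close> inverts \<open>v i\<close> modulo \<open>p\<close>, so
    \<open>c\<close> is the only possible ratio of \<open>w\<close> to \<open>v\<close>.\<close>
  define c where "c = a * w i"
  have *: "p dvd w j - c * v j" if "j \<in> {B1, B2}" for j
  proof -
    have "p dvd v i * w j - w i * v j"
      using wedge that i unfolding tensor_zero_def wedge_def by auto
    with a show ?thesis unfolding c_def by algebra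
  qed
  show ?thesis
  proof (cases "p dvd v B1 \<and> p dvd v B2")
    case True
    have "p dvd w j" if "j \<in> {B1, B2}" for j
    proof -
      have "p dvd v j" using True that by auto
      with *[OF that] show ?thesis by algebra
    qed
    with True show ?thesis by auto
  next
    case False
    then obtain j where j: "j \<in> {B1, B2}" "\<not> p dvd v j" by auto
    have "p dvd w k - c * v k" if "k \<in> {A1, A2}" for k
    proof -
      have "p dvd v k * w j - w k * v j"
        using wedge that j unfolding tensor_zero_def wedge_def by auto
      with *[OF j(1)] have "p dvd v j * (w k - c * v k)" by algebra
      then show ?thesis using p j by (simp add: prime_dvd_mult_iff)
    qed
    with * have "vec_zero p (\<lambda>x. w x - c * v x)" by (simp add: vec_zero_iff)
    then show ?thesis by blast
  qed
qed

section \<open>Images of the generators under an endomorphism\<close>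

text \<open>
  With \<open>e = p choose 2\<close> this is the \<open>p\<close>-th power map; the last term comes from
  \<open>(x y)\<^bsup>p\<^esup> = x\<^bsup>p\<^esup> y\<^bsup>p\<^esup> [y, x]\<^bsup>p choose 2\<^esup>\<close>.
\<close>

definition power_form :: "int \<Rightarrow> int \<Rightarrow> (jk_gen \<Rightarrow> int) \<Rightarrow> jk_gen \<Rightarrow> jk_gen \<Rightarrow> int" where
  "power_form l e v i j = power_map l v i j - e * v i * v j"

text \<open>\<open>f h\<close> is the exponent vector of the image of the generator \<open>h\<close> under an endomorphism.\<close>

definition jk_compatible :: "int \<Rightarrow> int \<Rightarrow> int \<Rightarrow> (jk_gen \<Rightarrow> jk_gen \<Rightarrow> int) \<Rightarrow> bool" where
  "jk_compatible p l e f \<longleftrightarrow>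
    tensor_zero p (wedge (f A1) (f A2)) \<and> tensor_zero p (wedge (f B1) (f B2)) \<and>
    tensor_zero p (\<lambda>i j. power_form l e (f A1) i j - wedge (f A1) (f B1) i j) \<and>
    tensor_zero p (\<lambda>i j. power_form l e (f A2) i j
      - (l * wedge (f A1) (f B1) i j + wedge (f A1) (f B2) i j)) \<and>
    tensor_zero p (\<lambda>i j. power_form l e (f B1) i j
      - (wedge (f A2) (f B1) i j + wedge (f A2) (f B2) i j)) \<and>
    tensor_zero p (\<lambda>i j. power_form l e (f B2) i j - wedge (f A2) (f B2) i j)"

text \<open>Zeros propagate along the relations: the power of \<open>f A2\<close> is a sum of
  commutators with \<open>f A1\<close>, and the powers of \<open>f B1\<close> and
  \<open>f B2\<close> are built from commutators with \<open>f A2\<close>. By \<open>inj\<close> a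
  vector with zero power is zero.\<close>

lemma jk_compatible_zero:
  assumes inj: "\<And>v. tensor_zero p (power_form l e v) \<Longrightarrow> vec_zero p v"
    and f: "jk_compatible p l e f" and A1: "vec_zero p (f A1)"
  shows "vec_zero p (f g)"
proof -
  have "tensor_zero p (power_form l e (f A2))"
    unfolding tensor_zero_def
  proof (intro ballI)
    fix i j assume ij: "i \<in> {A1, A2}" "j \<in> {B1, B2}"
    have "p dvd power_form l e (f A2) i j - (l * wedge (f A1) (f B1) i j + wedge (f A1) (f B2) i j)"
      "p dvd f A1 i" "p dvd f A1 j"
      using f ij A1 by (auto simp: jk_compatible_def tensor_zero_def vec_zero_def)
    then show "p dvd power_form l e (f A2) i j"
      unfolding wedge_def by algebra
  qed
  then have A2: "vec_zero p (f A2)" by (rule inj)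
  have "tensor_zero p (power_form l e (f B1))" "tensor_zero p (power_form l e (f B2))"
    unfolding tensor_zero_def
  proof (safe del: insertE)
    fix i j assume ij: "i \<in> {A1, A2}" "j \<in> {B1, B2}"
    have *: "p dvd power_form l e (f B1) i j - (wedge (f A2) (f B1) i j + wedge (f A2) (f B2) i j)"
      "p dvd power_form l e (f B2) i j - wedge (f A2) (f B2) i j"
      "p dvd f A2 i" "p dvd f A2 j"
      using f ij A2 by (auto simp: jk_compatible_def tensor_zero_def vec_zero_def)
    then show "p dvd power_form l e (f B1) i j"
      unfolding wedge_def by algebra
    show "p dvd power_form l e (f B2) i j"
      using *(2-) unfolding wedge_def by algebra
  qed
  then have "vec_zero p (f B1)" "vec_zero p (f B2)" by (auto intro: inj)
  with A1 A2 show ?thesis by (cases g) auto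
qed

text \<open>The power of \<open>f A1\<close> is a commutator with \<open>f B1\<close>, which reduces
  to the case \<open>f A1 = 0\<close>.\<close>

lemma jk_compatible_zero_B1:
  assumes inj: "\<And>v. tensor_zero p (power_form l e v) \<Longrightarrow> vec_zero p v"
    and f: "jk_compatible p l e f" and B1: "vec_zero p (f B1)"
  shows "vec_zero p (f g)"
proof -
  have "tensor_zero p (power_form l e (f A1))"
    unfolding tensor_zero_def
  proof (intro ballI)
    fix i j assume ij: "i \<in> {A1, A2}" "j \<in> {B1, B2}"
    have "p dvd power_form l e (f A1) i j - wedge (f A1) (f B1) i j"
      "p dvd f B1 i" "p dvd f B1 j"
      using f ij B1 by (auto simp: jk_compatible_def tensor_zero_def vec_zero_def)
    then show "p dvd power_form l e (f A1) i j"
      unfolding wedge_def by algebra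
  qed
  then have "vec_zero p (f A1)" by (rule inj)
  with inj f show ?thesis by (rule jk_compatible_zero)
qed

text \<open>The power of \<open>f B1\<close> is built from commutators with \<open>f A2\<close>,
  which reduces to the case \<open>f B1 = 0\<close>.\<close>

lemma jk_compatible_zero_A2:
  assumes inj: "\<And>v. tensor_zero p (power_form l e v) \<Longrightarrow> vec_zero p v"
    and f: "jk_compatible p l e f" and A2: "vec_zero p (f A2)"
  shows "vec_zero p (f g)"
proof -
  have "tensor_zero p (power_form l e (f B1))"
    unfolding tensor_zero_def
  proof (intro ballI)
    fix i j assume ij: "i \<in> {A1, A2}" "j \<in> {B1, B2}"
    have "p dvd power_form l e (f B1) i j - (wedge (f A2) (f B1) i j + wedge (f A2) (f B2) i j)"
      "p dvd f A2 i" "p dvd f A2 j"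
      using f ij A2 by (auto simp: jk_compatible_def tensor_zero_def vec_zero_def)
    then show "p dvd power_form l e (f B1) i j"
      unfolding wedge_def by algebra
  qed
  then have "vec_zero p (f B1)" by (rule inj)
  with inj f show ?thesis by (rule jk_compatible_zero_B1)
qed

text \<open>The case in which \<open>A\<close> is sent into \<open>B\<close> and \<open>B\<close>
  into \<open>A\<close>. Powers of vectors in \<open>B\<close> have zero row \<open>A1\<close> and
  powers of vectors in \<open>A\<close> have zero row \<open>A2\<close>. Comparing these rows with
  the commutators kills both coordinates of \<open>f B1\<close>.\<close>

lemma jk_compatible_swap:
  assumes p: "prime p" and inj: "\<And>v. tensor_zero p (power_form l e v) \<Longrightarrow> vec_zero p v"
    and f: "jk_compatible p l e f"
    and a: "\<forall>x\<in>{A1, A2}. p dvd f A1 x \<and> p dvd f A2 x"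
    and b: "\<forall>x\<in>{B1, B2}. p dvd f B1 x \<and> p dvd f B2 x"
  shows "vec_zero p (f g)"
proof (rule ccontr)
  assume "\<not> ?thesis"
  then have nz: "\<not> vec_zero p (f A1)" "\<not> vec_zero p (f A2)" "\<not> vec_zero p (f B1)"
    using jk_compatible_zero[OF inj f] jk_compatible_zero_A2[OF inj f]
      jk_compatible_zero_B1[OF inj f] by blast+
  obtain j where j: "j \<in> {B1, B2}" "\<not> p dvd f A1 j"
    using nz(1) a by (auto simp: vec_zero_iff)
  obtain k where k: "k \<in> {B1, B2}" "\<not> p dvd f A2 k"
    using nz(2) a by (auto simp: vec_zero_iff)
  have "p dvd power_form l e (f A1) A1 j - wedge (f A1) (f B1) A1 j"
    using f j by (auto simp: jk_compatible_def tensor_zero_def)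
  moreover have "p dvd power_form l e (f A1) A1 j"
    using a by (simp add: power_form_def power_map_def)
  moreover have "p dvd f A1 A1" using a by simp
  ultimately have "p dvd f B1 A1 * f A1 j" unfolding wedge_def by algebra
  then have 1: "p dvd f B1 A1" using p j by (simp add: prime_dvd_mult_iff)
  have "p dvd power_form l e (f B2) A2 k - wedge (f A2) (f B2) A2 k"
    using f k by (auto simp: jk_compatible_def tensor_zero_def)
  moreover have "p dvd power_form l e (f B2) A2 k"
    using b k by (auto simp: power_form_def power_map_def)
  moreover have A2: "p dvd f A2 A2" using a by simp
  ultimately have B2: "p dvd f B2 A2 * f A2 k" unfolding wedge_def by algebra
  have "p dvd power_form l e (f B1) A2 k - (wedge (f A2) (f B1) A2 k + wedge (f A2) (f B2) A2 k)"
    using f k by (auto simp: jk_compatible_def tensor_zero_def)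
  moreover have "p dvd power_form l e (f B1) A2 k"
    using b k by (auto simp: power_form_def power_map_def)
  ultimately have "p dvd f B1 A2 * f A2 k" using A2 B2 unfolding wedge_def by algebra
  then have "p dvd f B1 A2" using p k by (simp add: prime_dvd_mult_iff)
  with 1 b nz(3) show False by (simp add: vec_zero_iff)
qed

text \<open>If \<open>f A1\<close> and \<open>f B1\<close> lie in the same half, they commute, so
  \<open>f A1\<close> has zero power.\<close>

lemma jk_compatible_same_side:
  assumes inj: "\<And>v. tensor_zero p (power_form l e v) \<Longrightarrow> vec_zero p v"
    and f: "jk_compatible p l e f"
    and zero: "(\<forall>x\<in>{A1, A2}. p dvd f A1 x \<and> p dvd f B1 x) \<or> (\<forall>x\<in>{B1, B2}. p dvd f A1 x \<and> p dvd f B1 x)"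
  shows "vec_zero p (f g)"
proof -
  have "tensor_zero p (power_form l e (f A1))"
    unfolding tensor_zero_def
  proof (intro ballI)
    fix i j assume ij: "i \<in> {A1, A2}" "j \<in> {B1, B2}"
    have "p dvd power_form l e (f A1) i j - wedge (f A1) (f B1) i j"
      using f ij by (auto simp: jk_compatible_def tensor_zero_def)
    moreover have "p dvd wedge (f A1) (f B1) i j"
      using zero ij unfolding wedge_def by (auto intro!: dvd_diff)
    ultimately show "p dvd power_form l e (f A1) i j"
      by algebra
  qed
  then have "vec_zero p (f A1)" by (rule inj)
  with inj f show ?thesis by (rule jk_compatible_zero)
qed

text \<open>The case in which \<open>A\<close> and \<open>B\<close> are each preserved. Commutators
  then become products of an \<open>A\<close>-part and a \<open>B\<close>-part, and comparing matrix
  entries determines all coordinates one after another.\<close>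

lemma jk_compatible_straight:
  assumes p: "prime p" and inj: "\<And>v. tensor_zero p (power_form l e v) \<Longrightarrow> vec_zero p v"
    and f: "jk_compatible p l e f"
    and a: "\<forall>x\<in>{B1, B2}. p dvd f A1 x \<and> p dvd f A2 x"
    and b: "\<forall>x\<in>{A1, A2}. p dvd f B1 x \<and> p dvd f B2 x"
  shows "(\<forall>g. vec_zero p (f g)) \<or> (\<forall>g x. p dvd f g x - unit_vec g x)"
proof (subst disj_commute, rule disjCI)
  assume "\<not> (\<forall>g. vec_zero p (f g))"
  then have nz: "\<not> vec_zero p (f A1)" "\<not> vec_zero p (f B1)"
    using jk_compatible_zero[OF inj f] jk_compatible_zero_B1[OF inj f] by blast+
  have zero: "p dvd f A1 B1" "p dvd f A1 B2" "p dvd f A2 B1" "p dvd f A2 B2"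
    "p dvd f B1 A1" "p dvd f B1 A2" "p dvd f B2 A1" "p dvd f B2 A2"
    using a b by auto
  have r1: "p dvd power_map l (f A1) i j - f A1 i * f B1 j"
    and r2: "p dvd power_map l (f A2) i j - (l * f A1 i * f B1 j + f A1 i * f B2 j)"
    and r3: "p dvd power_map l (f B1) i j - f A2 i * (f B1 j + f B2 j)"
    and r4: "p dvd power_map l (f B2) i j - f A2 i * f B2 j"
    if ij: "i \<in> {A1, A2}" "j \<in> {B1, B2}" for i j
  proof -
    have r: "p dvd power_form l e (f A1) i j - wedge (f A1) (f B1) i j"
      "p dvd power_form l e (f A2) i j - (l * wedge (f A1) (f B1) i j + wedge (f A1) (f B2) i j)"
      "p dvd power_form l e (f B1) i j - (wedge (f A2) (f B1) i j + wedge (f A2) (f B2) i j)"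
      "p dvd power_form l e (f B2) i j - wedge (f A2) (f B2) i j"
      using f ij by (auto simp: jk_compatible_def tensor_zero_def)
    have z: "p dvd f A1 j" "p dvd f A2 j" "p dvd f B1 i" "p dvd f B2 i"
      using ij zero by auto
    note defs = power_form_def wedge_def
    show "p dvd power_map l (f A1) i j - f A1 i * f B1 j"
      using r(1) z(1) z(3) unfolding defs by algebra
    show "p dvd power_map l (f A2) i j - (l * f A1 i * f B1 j + f A1 i * f B2 j)"
      using r(2) z unfolding defs by algebra
    show "p dvd power_map l (f B1) i j - f A2 i * (f B1 j + f B2 j)"
      using r(3) z unfolding defs by algebra
    show "p dvd power_map l (f B2) i j - f A2 i * f B2 j"
      using r(4) z unfolding defs by algebra
  qed
  obtain j where j: "j \<in> {B1, B2}" "\<not> p dvd f B1 j"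
    using nz(2) b by (auto simp: vec_zero_iff)
  \<comment> \<open>The power of a vector in \<open>A\<close> has zero row \<open>A2\<close>,
    whereas the commutator has entry \<open>f A1 A2 * f B1 j\<close> there.\<close>
  have "p dvd power_map l (f A1) A2 j" using a by (auto simp: power_map_def)
  with r1[of A2 j] j have "p dvd f A1 A2 * f B1 j" by (auto simp: dvd_diff_right_iff)
  then have A12: "p dvd f A1 A2" using p j by (simp add: prime_dvd_mult_iff)
  then have A11: "\<not> p dvd f A1 A1" using nz(1) a by (auto simp: vec_zero_iff)
  have "p dvd f A1 A1 + l * f A1 A2 - f A1 A1 * f B1 B1"
    using r1[of A1 B1] by (simp add: power_map_def)
  with A12 have "p dvd f A1 A1 * (f B1 B1 - 1)" by algebra
  then have B11: "p dvd f B1 B1 - 1" using p A11 by (simp add: prime_dvd_mult_iff)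
  have "p dvd f A1 A2 - f A1 A1 * f B1 B2"
    using r1[of A1 B2] by (simp add: power_map_def)
  with A12 have "p dvd f A1 A1 * f B1 B2" by algebra
  then have B12: "p dvd f B1 B2" using p A11 by (simp add: prime_dvd_mult_iff)
  have q1: "p dvd f B1 B1 - f A2 A2 * (f B1 B1 + f B2 B1)"
    and q2: "p dvd f B1 B1 + f B1 B2 - f A2 A2 * (f B1 B2 + f B2 B2)"
    and q3: "p dvd f B2 B1 - f A2 A2 * f B2 B1"
    and q4: "p dvd f B2 B1 + f B2 B2 - f A2 A2 * f B2 B2"
    using r3[of A2 B1] r3[of A2 B2] r4[of A2 B1] r4[of A2 B2] by (simp_all add: power_map_def)
  have q1': "p dvd 1 - f A2 A2 * (1 + f B2 B1)" using q1 B11 by algebra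
  have q2': "p dvd 1 - f A2 A2 * f B2 B2" using q2 B11 B12 by algebra
  \<comment> \<open>Whichever factor vanishes, \<open>q1'\<close> makes the other one vanish
    too.\<close>
  have "p dvd f B2 B1 * (f A2 A2 - 1)" using q3 by algebra
  then consider "p dvd f B2 B1" | "p dvd f A2 A2 - 1"
    using p by (auto simp: prime_dvd_mult_iff)
  then have B21: "p dvd f B2 B1" and A22: "p dvd f A2 A2 - 1"
  proof (atomize (full), cases)
    case 1
    with q1' have "p dvd f A2 A2 - 1" by algebra
    with 1 show "p dvd f B2 B1 \<and> p dvd f A2 A2 - 1" by blast
  next
    case 2
    with q1' have "p dvd f B2 B1" by algebra
    with 2 show "p dvd f B2 B1 \<and> p dvd f A2 A2 - 1" by blast
  qed
  have B22: "p dvd f B2 B2 - 1" using q2' A22 by algebra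
  have "p dvd f A2 A2 - (l * f A1 A1 * f B1 B2 + f A1 A1 * f B2 B2)"
    using r2[of A1 B2] by (simp add: power_map_def)
  then have A11': "p dvd f A1 A1 - 1" using A22 B12 B22 by algebra
  have "p dvd f A2 A1 * (f B1 B1 + f B2 B1)"
    using r3[of A1 B1] zero by (simp add: power_map_def dvd_diff_right_iff)
  then have A21: "p dvd f A2 A1" using B11 B21 by algebra
  show "\<forall>g x. p dvd f g x - unit_vec g x"
  proof (intro allI)
    fix g x
    show "p dvd f g x - unit_vec g x"
      by (cases g; cases x) (use zero A12 B11 B12 A22 B21 B22 A11' A21 in \<open>auto simp: unit_vec_def\<close>)
  qed
qed

text \<open>Proportional or zero images are excluded by the last three hypotheses. Hence the
  commuting images of \<open>A1\<close> and \<open>A2\<close> lie in one half, and so do those of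
  \<open>B1\<close> and \<open>B2\<close>; the four combinations are the straight case, the swap and
  twice the same side.\<close>

lemma jk_compatible_cases:
  assumes p: "prime p" and inj: "\<And>v. tensor_zero p (power_form l e v) \<Longrightarrow> vec_zero p v"
    and f: "jk_compatible p l e f"
    and prop_A: "\<And>c. vec_zero p (\<lambda>x. f A2 x - c * f A1 x) \<Longrightarrow> \<forall>g. vec_zero p (f g)"
    and prop_B: "\<And>c. vec_zero p (\<lambda>x. f B1 x - c * f B2 x) \<Longrightarrow> \<forall>g. vec_zero p (f g)"
    and zero_B2: "vec_zero p (f B2) \<Longrightarrow> \<forall>g. vec_zero p (f g)"
  shows "(\<forall>g. vec_zero p (f g)) \<or> (\<forall>g x. p dvd f g x - unit_vec g x)"
proof (rule ccontr)
  assume *: "\<not> ?thesis"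
  have "tensor_zero p (wedge (f A1) (f A2))" using f by (simp add: jk_compatible_def)
  from wedge_zero_cases[OF p this] have A: "(\<forall>x\<in>{B1, B2}. p dvd f A1 x \<and> p dvd f A2 x) \<or>
      (\<forall>x\<in>{A1, A2}. p dvd f A1 x \<and> p dvd f A2 x)"
    using * jk_compatible_zero[OF inj f] prop_A by blast
  \<comment> \<open>The order is reversed so that proportionality expresses \<open>f B1\<close>
    through \<open>f B2\<close>, as in \<open>prop_B\<close>.\<close>
  have "tensor_zero p (wedge (f B2) (f B1))"
    using f by (auto simp: jk_compatible_def tensor_zero_def wedge_def algebra_simps dvd_diff_commute)
  from wedge_zero_cases[OF p this] have B: "(\<forall>x\<in>{B1, B2}. p dvd f B2 x \<and> p dvd f B1 x) \<or>
      (\<forall>x\<in>{A1, A2}. p dvd f B2 x \<and> p dvd f B1 x)"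
    using * zero_B2 prop_B by blast
  from A B show False
    using * jk_compatible_swap[OF p inj f] jk_compatible_straight[OF p inj f]
      jk_compatible_same_side[OF inj f] by blast
qed

text \<open>With \<open>e = 0\<close> the power map is linear and injective, so a linear relation
  between powers is one between the vectors. Below, P denotes the power map and [v, w] the
  commutator \<open>wedge\<close>.\<close>

lemma jk_compatible_odd:
  assumes p: "prime p" and f: "jk_compatible p l 0 f"
  shows "(\<forall>g. vec_zero p (f g)) \<or> (\<forall>g x. p dvd f g x - unit_vec g x)"
proof -
  have inj: "vec_zero p v" if "tensor_zero p (power_form l 0 v)" for v
  proof -
    have "p dvd v A1 + l * v A2" "p dvd v A2" "p dvd v B1" "p dvd v B1 + v B2"
      using that by (auto simp: tensor_zero_iff power_form_def power_map_def)
    then show ?thesis by (auto simp: vec_zero_iff dvd_add_left_iff dvd_add_right_iff)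
  qed
  have rel: "p dvd power_map l (f A1) i j - wedge (f A1) (f B1) i j"
      "p dvd power_map l (f A2) i j - (l * wedge (f A1) (f B1) i j + wedge (f A1) (f B2) i j)"
      "p dvd power_map l (f B1) i j - (wedge (f A2) (f B1) i j + wedge (f A2) (f B2) i j)"
      "p dvd power_map l (f B2) i j - wedge (f A2) (f B2) i j"
      if "i \<in> {A1, A2}" "j \<in> {B1, B2}" for i j
      using f that by (auto simp: jk_compatible_def tensor_zero_def power_form_def)
  have prop_A: "\<forall>g. vec_zero p (f g)" if c: "vec_zero p (\<lambda>x. f A2 x - c * f A1 x)" for c
  proof -
    \<comment> \<open>P(B1) = [A2, B1] + [A2, B2] = c P(A1) + P(B2). The coefficients are spelled
      out to match \<open>power_map_linear\<close>.\<close>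
    have "vec_zero p (\<lambda>x. 1 * f B1 x + (- 1) * (c * f A1 x + 1 * f B2 x))"
    proof (rule inj, unfold tensor_zero_def, intro ballI)
      fix i j assume ij: "i \<in> {A1, A2}" "j \<in> {B1, B2}"
      have "p dvd f A2 i - c * f A1 i" "p dvd f A2 j - c * f A1 j"
        using c by (auto simp: vec_zero_def)
      with rel(1,3,4)[OF ij] show "p dvd power_form l 0 (\<lambda>x. 1 * f B1 x + (- 1) * (c * f A1 x + 1 * f B2 x)) i j"
        unfolding power_form_def power_map_linear wedge_def by algebra
    qed
    then have B1: "p dvd f B1 x - (c * f A1 x + f B2 x)" for x by (simp add: vec_zero_def algebra_simps)
    \<comment> \<open>Now P(B2) = c [A1, B2] = c [A1, B1 - c A1] = c P(A1).\<close>
    have "vec_zero p (\<lambda>x. 1 * f B2 x + (- c) * f A1 x)"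
    proof (rule inj, unfold tensor_zero_def, intro ballI)
      fix i j assume ij: "i \<in> {A1, A2}" "j \<in> {B1, B2}"
      have "p dvd f A2 i - c * f A1 i" "p dvd f A2 j - c * f A1 j"
        using c by (auto simp: vec_zero_def)
      with rel(1,4)[OF ij] B1[of i] B1[of j] show "p dvd power_form l 0 (\<lambda>x. 1 * f B2 x + (- c) * f A1 x) i j"
        unfolding power_form_def power_map_linear wedge_def by algebra
    qed
    then have B2: "p dvd f B2 x - c * f A1 x" for x by (simp add: vec_zero_def)
    \<comment> \<open>Both \<open>f B1\<close> and \<open>f B2\<close> are now multiples of
      \<open>f A1\<close>, so P(A1) = [A1, B1] = 0.\<close>
    have "vec_zero p (f A1)"
    proof (rule inj, unfold tensor_zero_def, intro ballI)
      fix i j assume ij: "i \<in> {A1, A2}" "j \<in> {B1, B2}"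
      show "p dvd power_form l 0 (f A1) i j"
        using rel(1)[OF ij] B1[of i] B1[of j] B2[of i] B2[of j]
        unfolding power_form_def wedge_def by algebra
    qed
    then show ?thesis using jk_compatible_zero[OF inj f] by blast
  qed
  have zero_B2: "\<forall>g. vec_zero p (f g)" if B2: "vec_zero p (f B2)"
  proof (rule prop_A)
    \<comment> \<open>Without the term [A1, B2] the second power relation reads P(A2) = l
      P(A1).\<close>
    have "vec_zero p (\<lambda>x. 1 * f A2 x + (- l) * f A1 x)"
    proof (rule inj, unfold tensor_zero_def, intro ballI)
      fix i j assume ij: "i \<in> {A1, A2}" "j \<in> {B1, B2}"
      have "p dvd f B2 i" "p dvd f B2 j"
        using B2 by (auto simp: vec_zero_def)
      with rel(1,2)[OF ij] show "p dvd power_form l 0 (\<lambda>x. 1 * f A2 x + (- l) * f A1 x) i j"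
        unfolding power_form_def power_map_linear wedge_def by algebra
    qed
    then show "vec_zero p (\<lambda>x. f A2 x - l * f A1 x)" by simp
  qed
  have "\<forall>g. vec_zero p (f g)" if c: "vec_zero p (\<lambda>x. f B1 x - c * f B2 x)" for c
  \<comment> \<open>From B1 = c B2 follow both P(B1) = c P(B2) and P(B1) = (c + 1) [A2, B2] = (c +
    1) P(B2), hence P(B2) = 0.\<close>
  proof (rule zero_B2, rule inj, unfold tensor_zero_def, intro ballI)
    have "p dvd power_map l (\<lambda>x. 1 * f B1 x + (- c) * f B2 x) i j" for i j
      using c unfolding power_map_def vec_zero_def by (auto intro!: dvd_add)
    then have *: "p dvd power_map l (f B1) i j - c * power_map l (f B2) i j" for i j
      unfolding power_map_linear by simp
    fix i j assume ij: "i \<in> {A1, A2}" "j \<in> {B1, B2}"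
    have "p dvd f B1 i - c * f B2 i" "p dvd f B1 j - c * f B2 j"
      using c by (auto simp: vec_zero_def)
    with rel(3,4)[OF ij] *[of i j] show "p dvd power_form l 0 (f B2) i j"
      unfolding power_form_def wedge_def by algebra
  qed
  then show ?thesis
    using p inj f prop_A zero_B2 by (intro jk_compatible_cases) auto
qed

text \<open>Here the power map is quadratic, but modulo 2 the factor \<open>c\<close> is 0 or 1, so
  proportionality means that a vector is zero or that two vectors are equal.\<close>

lemma jk_compatible_two:
  assumes f: "jk_compatible 2 0 1 f"
  shows "(\<forall>g. vec_zero 2 (f g)) \<or> (\<forall>g x. 2 dvd f g x - unit_vec g x)"
proof -
  \<comment> \<open>If \<open>v B1\<close> were odd, entry \<open>(A2, B1)\<close> would make
    \<open>v A2\<close> odd and entry \<open>(A2, B2)\<close> would be odd; with \<open>v B1\<close>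
    even the remaining coordinates vanish in turn.\<close>
  have inj: "vec_zero 2 v" if "tensor_zero 2 (power_form 0 1 v)" for v
    using that by (auto simp: tensor_zero_iff vec_zero_iff power_form_def power_map_def)
  have rel: "2 dvd power_form 0 1 (f A1) i j - wedge (f A1) (f B1) i j"
      "2 dvd power_form 0 1 (f A2) i j - wedge (f A1) (f B2) i j"
      "2 dvd power_form 0 1 (f B1) i j - (wedge (f A2) (f B1) i j + wedge (f A2) (f B2) i j)"
      "2 dvd power_form 0 1 (f B2) i j - wedge (f A2) (f B2) i j"
      if "i \<in> {A1, A2}" "j \<in> {B1, B2}" for i j
    using f that by (auto simp: jk_compatible_def tensor_zero_def)
  have prop_A: "\<forall>g. vec_zero 2 (f g)" if c: "vec_zero 2 (\<lambda>x. f A2 x - c * f A1 x)" for c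
  proof (cases "even c")
    case True
    then have "vec_zero 2 (f A2)" using c by (simp add: vec_zero_def)
    then show ?thesis using jk_compatible_zero_A2[OF inj f] by blast
  next
    case False
    then have *: "even (f A2 x) \<longleftrightarrow> even (f A1 x)" for x using c by (simp add: vec_zero_def)
    \<comment> \<open>With equal images of \<open>A1\<close> and \<open>A2\<close>, the power of
      \<open>f B1\<close> is the sum of the powers of \<open>f A1\<close> and \<open>f A2\<close>,
      which is twice one of them.\<close>
    have "vec_zero 2 (f B1)"
    proof (rule inj, unfold tensor_zero_def, intro ballI)
      fix i j assume ij: "i \<in> {A1, A2}" "j \<in> {B1, B2}"
      have "even (power_form 0 1 (f A2) i j) \<longleftrightarrow> even (power_form 0 1 (f A1) i j)"
        using * by (simp add: power_form_def power_map_def)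
      with rel(1-3)[OF ij] *[of i] *[of j] show "2 dvd power_form 0 1 (f B1) i j"
        unfolding wedge_def by auto
    qed
    then show ?thesis using jk_compatible_zero_B1[OF inj f] by blast
  qed
  have zero_B2: "\<forall>g. vec_zero 2 (f g)" if B2: "vec_zero 2 (f B2)"
  proof -
    have "vec_zero 2 (f A2)"
    proof (rule inj, unfold tensor_zero_def, intro ballI)
      fix i j assume ij: "i \<in> {A1, A2}" "j \<in> {B1, B2}"
      show "2 dvd power_form 0 1 (f A2) i j"
        using rel(2)[OF ij] B2 unfolding wedge_def vec_zero_def by simp
    qed
    then show ?thesis using jk_compatible_zero_A2[OF inj f] by blast
  qed
  have "\<forall>g. vec_zero 2 (f g)" if c: "vec_zero 2 (\<lambda>x. f B1 x - c * f B2 x)" for c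
  proof -
    have "vec_zero 2 (f B1)"
    proof (cases "even c")
      case True
      then show ?thesis using c by (simp add: vec_zero_def)
    next
      case False
      then have *: "even (f B1 x) \<longleftrightarrow> even (f B2 x)" for x using c by (simp add: vec_zero_def)
      \<comment> \<open>With equal images of \<open>B1\<close> and \<open>B2\<close>, the third
        relation makes the power of \<open>f B1\<close> twice a commutator.\<close>
      show ?thesis
      proof (rule inj, unfold tensor_zero_def, intro ballI)
        fix i j assume ij: "i \<in> {A1, A2}" "j \<in> {B1, B2}"
        show "2 dvd power_form 0 1 (f B1) i j"
          using rel(3)[OF ij] *[of i] *[of j] unfolding wedge_def by auto
      qed
    qed
    then show ?thesis using jk_compatible_zero_B1[OF inj f] by blast
  qed
  then show ?thesis
    using inj f prop_A zero_B2 by (intro jk_compatible_cases) auto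
qed

subsection \<open>Normal forms in groups of class two\<close>

text \<open>Here \<open>w\<close> is the conjugate of \<open>x\<close> by \<open>y\<close>; avoiding
  inverses in the hypothesis makes natural exponents a plain induction.\<close>

lemma (in group) conj_int_pow:
  assumes "x \<in> carrier G" "y \<in> carrier G" "w \<in> carrier G" "y \<otimes> x = w \<otimes> y"
  shows "y \<otimes> x [^] (i::int) = w [^] i \<otimes> y"
proof -
  have nat: "y \<otimes> x [^] (n::nat) = w [^] n \<otimes> y" for n
  proof (induction n)
    case (Suc n)
    have "y \<otimes> x [^] Suc n = (y \<otimes> x [^] n) \<otimes> x" using assms by (simp add: m_assoc)
    also have "\<dots> = w [^] n \<otimes> (y \<otimes> x)" unfolding Suc using assms(1-3) by (simp add: m_assoc)
    also have "\<dots> = w [^] Suc n \<otimes> y" unfolding assms(4) using assms(1-3) by (simp add: m_assoc)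
    finally show ?case .
  qed (use assms in simp)
  show ?thesis
  proof (cases i rule: int_cases2)
    case (nonneg n)
    then show ?thesis using nat by (simp add: int_pow_int)
  next
    case (nonpos n)
    have "w [^] n \<otimes> (y \<otimes> inv (x [^] n)) = (w [^] n \<otimes> y) \<otimes> inv (x [^] n)"
      using assms by (simp add: m_assoc)
    also have "\<dots> = y" unfolding nat[symmetric] using assms by (simp add: m_assoc)
    finally have "y \<otimes> inv (x [^] n) = inv (w [^] n) \<otimes> y"
      using assms by (intro inv_solve_left[THEN iffD2]) auto
    then show ?thesis using nonpos assms by (simp add: int_pow_neg_int)
  qed
qed

definition central :: "('a, 'b) monoid_scheme \<Rightarrow> 'a \<Rightarrow> bool" where
  "central G z \<longleftrightarrow> z \<in> carrier G \<and> (\<forall>y\<in>carrier G. z \<otimes>\<^bsub>G\<^esub> y = y \<otimes>\<^bsub>G\<^esub> z)"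

context group
begin

lemma central_closed: "central G z \<Longrightarrow> z \<in> carrier G"
  by (simp add: central_def)

lemma central_commute: "central G z \<Longrightarrow> y \<in> carrier G \<Longrightarrow> z \<otimes> y = y \<otimes> z"
  by (simp add: central_def)

lemma central_mult:
  assumes "central G y" "central G z"
  shows "central G (y \<otimes> z)"
proof -
  have "y \<otimes> z \<otimes> x = x \<otimes> (y \<otimes> z)" if "x \<in> carrier G" for x
  proof -
    have "y \<otimes> (z \<otimes> x) = (y \<otimes> x) \<otimes> z"
      using assms that central_commute[of z x] by (simp add: m_assoc central_closed)
    then show ?thesis
      using assms that central_commute[of y x] by (simp add: m_assoc central_closed)
  qed
  then show ?thesis using assms[THEN central_closed] unfolding central_def by blast
qed

lemma central_int_pow:
  assumes "central G z"
  shows "central G (z [^] (i::int))"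
proof -
  have "y \<otimes> z [^] i = z [^] i \<otimes> y" if "y \<in> carrier G" for y
    using that central_closed[OF assms] central_commute[OF assms that]
    by (intro conj_int_pow) auto
  then show ?thesis
    using int_pow_closed[OF central_closed[OF assms]] unfolding central_def by metis
qed

lemma central_pull:
  assumes "x \<in> carrier G" "y \<in> carrier G" "central G z" "central G z'"
  shows "(x \<otimes> z) \<otimes> (y \<otimes> z') = (x \<otimes> y) \<otimes> (z \<otimes> z')"
proof -
  have "z \<otimes> (y \<otimes> z') = y \<otimes> (z \<otimes> z')"
    using assms central_commute[of z y] by (simp add: central_closed m_assoc[symmetric])
  then show ?thesis
    using assms by (simp add: central_closed m_assoc)
qed

lemma central_int_pow_mult:
  assumes "x \<in> carrier G" "central G z"
  shows "(x \<otimes> z) [^] (i::int) = x [^] i \<otimes> z [^] i"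
  using assms central_commute[OF assms(2,1)] by (intro int_pow_mult_distrib) (auto dest: central_closed)

lemma int_pow_commutator:
  assumes "x \<in> carrier G" "y \<in> carrier G" "central G z" "y \<otimes> x = x \<otimes> y \<otimes> z"
  shows "y [^] (j::int) \<otimes> x [^] (i::int) = x [^] i \<otimes> y [^] j \<otimes> z [^] (i * j)"
proof -
  have z: "z \<in> carrier G" and zi: "central G (z [^] i)" "z [^] i \<in> carrier G"
    using assms(3) central_int_pow central_closed by auto
  have "y \<otimes> x = x \<otimes> z \<otimes> y"
    using assms z central_commute[OF assms(3), of y] by (simp add: m_assoc)
  then have "y \<otimes> x [^] i = (x \<otimes> z) [^] i \<otimes> y"
    using assms z by (intro conj_int_pow) auto
  then have "y \<otimes> x [^] i = x [^] i \<otimes> (z [^] i \<otimes> y)"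
    using assms(1-3) zi z by (simp only: central_int_pow_mult m_assoc int_pow_closed)
  then have "x [^] i \<otimes> (y \<otimes> z [^] i) = y \<otimes> x [^] i"
    using central_commute[OF zi(1) assms(2)] by simp
  \<comment> \<open>A second use of \<open>conj_int_pow\<close>, with \<open>x [^] i\<close> as the
    conjugating element.\<close>
  then have "x [^] i \<otimes> (y \<otimes> z [^] i) [^] j = y [^] j \<otimes> x [^] i"
    using assms(1,2) zi by (intro conj_int_pow) auto
  then show ?thesis
    using assms(1,2) zi z by (simp add: central_int_pow_mult m_assoc int_pow_pow)
qed

definition commutator :: "'a \<Rightarrow> 'a \<Rightarrow> 'a" where
  "commutator x y = inv x \<otimes> inv y \<otimes> x \<otimes> y"

lemma commutator_closed: "x \<in> carrier G \<Longrightarrow> y \<in> carrier G \<Longrightarrow> commutator x y \<in> carrier G"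
  by (simp add: commutator_def)

lemma commutator_eq_iff:
  assumes "x \<in> carrier G" "y \<in> carrier G" "d \<in> carrier G"
  shows "commutator x y = d \<longleftrightarrow> x \<otimes> y = y \<otimes> x \<otimes> d"
proof -
  have "commutator x y = inv (y \<otimes> x) \<otimes> (x \<otimes> y)"
    using assms by (simp add: commutator_def inv_mult_group m_assoc)
  then show ?thesis
    using assms inv_solve_left[of d "y \<otimes> x" "x \<otimes> y"] by auto
qed

lemma mult_commutator:
  "x \<in> carrier G \<Longrightarrow> y \<in> carrier G \<Longrightarrow> x \<otimes> y = y \<otimes> x \<otimes> commutator x y"
  using commutator_eq_iff[of x y "commutator x y"] by (simp add: commutator_closed)

lemma central_inv: "central G z \<Longrightarrow> central G (inv z)"
  using central_int_pow[of z "- 1"] by (simp add: int_pow_neg central_closed)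

lemma central_one: "central G \<one>"
  by (simp add: central_def)

lemma central_right:
  assumes "x \<in> carrier G" "y \<in> carrier G" "central G z"
  shows "x \<otimes> z \<otimes> y = x \<otimes> y \<otimes> z"
  using assms central_closed[OF assms(3)] by (simp add: m_assoc central_commute[OF assms(3,2)])

text \<open>Moves \<open>y\<close> past a product one factor at a time, gathering the central
  corrections at the end.\<close>

lemma push_mult:
  assumes "a \<in> carrier G" "b \<in> carrier G" "y \<in> carrier G" "central G z" "central G z'"
    and "y \<otimes> a = a \<otimes> y \<otimes> z" "y \<otimes> b = b \<otimes> y \<otimes> z'"
  shows "y \<otimes> (a \<otimes> b) = (a \<otimes> b) \<otimes> y \<otimes> (z \<otimes> z')"
proof -
  note c = assms(1-3) central_closed[OF assms(4)] central_closed[OF assms(5)]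
  have "y \<otimes> (a \<otimes> b) = (y \<otimes> a) \<otimes> b" using c by (simp add: m_assoc)
  also have "\<dots> = a \<otimes> y \<otimes> b \<otimes> z"
    unfolding assms(6) using c assms(4) by (intro central_right) auto
  also have "\<dots> = a \<otimes> (y \<otimes> b) \<otimes> z" using c by (simp add: m_assoc)
  also have "\<dots> = (a \<otimes> b) \<otimes> y \<otimes> (z' \<otimes> z)" unfolding assms(7) using c by (simp add: m_assoc)
  also have "z' \<otimes> z = z \<otimes> z'" using central_commute[OF assms(5) c(4)] .
  finally show ?thesis .
qed

lemma central_pull4:
  assumes "x1 \<in> carrier G" "x2 \<in> carrier G" "x3 \<in> carrier G" "x4 \<in> carrier G"
    and "central G z1" "central G z2" "central G z3" "central G z4"
  shows "(x1 \<otimes> z1) \<otimes> (x2 \<otimes> z2) \<otimes> (x3 \<otimes> z3) \<otimes> (x4 \<otimes> z4) =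
    (x1 \<otimes> x2 \<otimes> x3 \<otimes> x4) \<otimes> (z1 \<otimes> z2 \<otimes> z3 \<otimes> z4)"
  using assms by (simp add: central_pull central_mult)

lemma commutator_mult_right:
  assumes "x \<in> carrier G" "y \<in> carrier G" "z \<in> carrier G"
    and "central G (commutator x y)" "central G (commutator x z)"
  shows "commutator x (y \<otimes> z) = commutator x y \<otimes> commutator x z"
proof -
  have "x \<otimes> (y \<otimes> z) = (y \<otimes> z) \<otimes> x \<otimes> (commutator x y \<otimes> commutator x z)"
    using assms by (intro push_mult mult_commutator)
  then show ?thesis
    using assms by (subst commutator_eq_iff) (auto simp: central_closed)
qed

lemma int_pow_commute:
  assumes "x \<in> carrier G" "y \<in> carrier G" "central G (commutator x y)"
  shows "y [^] (j::int) \<otimes> x [^] (i::int) = x [^] i \<otimes> y [^] j \<otimes> commutator x y [^] (- (i * j))"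
proof -
  let ?c = "commutator x y"
  have c: "?c \<in> carrier G" using assms by (simp add: commutator_closed)
  have "x \<otimes> y \<otimes> inv ?c = y \<otimes> x"
    unfolding mult_commutator[OF assms(1,2)] using assms c by (simp add: m_assoc)
  then have "y [^] j \<otimes> x [^] i = x [^] i \<otimes> y [^] j \<otimes> (inv ?c) [^] (i * j)"
    using assms by (intro int_pow_commutator) (auto intro: central_inv)
  then show ?thesis
    using c by (simp add: int_pow_inv int_pow_neg)
qed

lemma commutator_int_pow_right:
  assumes "x \<in> carrier G" "y \<in> carrier G" "central G (commutator x y)"
  shows "commutator x (y [^] (j::int)) = commutator x y [^] j"
proof -
  let ?c = "commutator x y"
  have c: "?c \<in> carrier G" using assms by (simp add: commutator_closed)
  have "y [^] j \<otimes> x = x \<otimes> y [^] j \<otimes> ?c [^] (- j)"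
    using int_pow_commute[OF assms, of j 1] assms(1) by simp
  then have "y [^] j \<otimes> x \<otimes> ?c [^] j = x \<otimes> y [^] j \<otimes> (?c [^] (- j) \<otimes> ?c [^] j)"
    using assms c by (simp add: m_assoc)
  also have "?c [^] (- j) \<otimes> ?c [^] j = \<one>"
    using c by (simp flip: int_pow_mult)
  finally show ?thesis
    using assms c by (subst commutator_eq_iff) auto
qed

end

section \<open>Collection in a group with four elements satisfying the JK relations\<close>

locale jk_generated = group G for G (structure) +
  fixes p l :: nat and g :: "jk_gen \<Rightarrow> 'a"
  assumes g_closed: "g h \<in> carrier G"
    and commutator_central: "x \<in> carrier G \<Longrightarrow> y \<in> carrier G \<Longrightarrow> central G (commutator x y)"
    and g_A1_pow: "g A1 [^] p = commutator (g A1) (g B1)"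
    and g_A2_pow: "g A2 [^] p = commutator (g A1) (g B1 [^] l \<otimes> g B2)"
    and g_B1_pow: "g B1 [^] p = commutator (g A2) (g B1 \<otimes> g B2)"
    and g_B2_pow: "g B2 [^] p = commutator (g A2) (g B2)"
    and commutator_A: "commutator (g A1) (g A2) = \<one>"
    and commutator_B: "commutator (g B1) (g B2) = \<one>"
begin

definition c :: "jk_gen \<Rightarrow> jk_gen \<Rightarrow> 'a" where
  "c i j = commutator (g i) (g j)"

definition generator_part :: "(jk_gen \<Rightarrow> int) \<Rightarrow> 'a" where
  "generator_part n = g A1 [^] n A1 \<otimes> g A2 [^] n A2 \<otimes> g B1 [^] n B1 \<otimes> g B2 [^] n B2"

definition commutator_part :: "(jk_gen \<Rightarrow> jk_gen \<Rightarrow> int) \<Rightarrow> 'a" where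
  "commutator_part m =
    c A1 B1 [^] m A1 B1 \<otimes> c A1 B2 [^] m A1 B2 \<otimes> c A2 B1 [^] m A2 B1 \<otimes> c A2 B2 [^] m A2 B2"

lemma c_central: "central G (c i j)"
  by (simp add: c_def commutator_central g_closed)

lemma c_closed: "c i j \<in> carrier G"
  using c_central by (rule central_closed)

lemma g_commute:
  "g j [^] (s::int) \<otimes> g i [^] (r::int) = g i [^] r \<otimes> g j [^] s \<otimes> c i j [^] (- (r * s))"
  unfolding c_def by (intro int_pow_commute g_closed commutator_central)

lemma c_AB: "c A1 A2 = \<one>" "c B1 B2 = \<one>"
  by (simp_all add: c_def commutator_A commutator_B)

lemma commutator_part_central: "central G (commutator_part m)"
  unfolding commutator_part_def by (intro central_mult central_int_pow c_central)

lemma commutator_part_closed: "commutator_part m \<in> carrier G"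
  using commutator_part_central by (rule central_closed)

lemma generator_part_closed: "generator_part n \<in> carrier G"
  by (simp add: generator_part_def g_closed)

lemma commutator_part_mult:
  "commutator_part m \<otimes> commutator_part m' = commutator_part (\<lambda>i j. m i j + m' i j)"
  unfolding commutator_part_def int_pow_mult[OF c_closed]
  by (rule central_pull4[symmetric]) (auto simp: central_int_pow c_central c_closed)

lemma commutator_part_pow:
  "commutator_part m [^] (s::int) = commutator_part (\<lambda>i j. s * m i j)"
  unfolding commutator_part_def
  by (simp add: central_int_pow_mult central_int_pow central_mult c_central c_closed int_pow_pow
      mult.commute)

text \<open>Only the factors preceding \<open>g h\<close> in the fixed order are crossed, and only a
  \<open>B\<close> crossing an \<open>A\<close> leaves a commutator.\<close>

lemma generator_part_step:
  "g h [^] (s::int) \<otimes> generator_part n =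
    generator_part (\<lambda>x. s * unit_vec h x + n x) \<otimes>
    commutator_part (\<lambda>i j. - (s * unit_vec h j * n i))"
proof (cases h)
  case A1
  then show ?thesis
    by (simp add: generator_part_def commutator_part_def unit_vec_def g_closed c_closed int_pow_mult m_assoc)
next
  case A2
  have *: "g A2 [^] s \<otimes> g A1 [^] n A1 = g A1 [^] n A1 \<otimes> g A2 [^] s"
    using g_commute[of A2 s A1 "n A1"] by (simp add: c_AB g_closed)
  have "g A2 [^] s \<otimes> generator_part n =
    (g A2 [^] s \<otimes> g A1 [^] n A1) \<otimes> g A2 [^] n A2 \<otimes> g B1 [^] n B1 \<otimes> g B2 [^] n B2"
    by (simp add: generator_part_def g_closed m_assoc)
  then show ?thesis
    unfolding * A2
    by (simp add: generator_part_def commutator_part_def unit_vec_def g_closed c_closed int_pow_mult m_assoc)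
next
  case B1
  let ?a = "g A1 [^] n A1 \<otimes> g A2 [^] n A2" and ?z = "c A1 B1 [^] (- (n A1 * s)) \<otimes> c A2 B1 [^] (- (n A2 * s))"
  have z: "central G ?z" by (intro central_mult central_int_pow c_central)
  have *: "g B1 [^] s \<otimes> ?a = ?a \<otimes> g B1 [^] s \<otimes> ?z"
    by (intro push_mult g_commute) (auto simp: g_closed central_int_pow c_central)
  have "g B1 [^] s \<otimes> generator_part n = (g B1 [^] s \<otimes> ?a) \<otimes> (g B1 [^] n B1 \<otimes> g B2 [^] n B2)"
    by (simp add: generator_part_def g_closed m_assoc)
  also have "\<dots> = ?a \<otimes> g B1 [^] s \<otimes> (g B1 [^] n B1 \<otimes> g B2 [^] n B2) \<otimes> ?z"
    unfolding * by (intro central_right z) (auto simp: g_closed)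
  finally show ?thesis
    unfolding B1
    by (simp add: generator_part_def commutator_part_def unit_vec_def g_closed c_closed int_pow_mult
        m_assoc mult.commute)
next
  case B2
  \<comment> \<open>The final \<open>\<one>\<close> is the trivial correction for crossing
    \<open>g B1\<close>, kept in the shape required by \<open>push_mult\<close>.\<close>
  let ?a = "g A1 [^] n A1 \<otimes> g A2 [^] n A2 \<otimes> g B1 [^] n B1"
    and ?z = "c A1 B2 [^] (- (n A1 * s)) \<otimes> c A2 B2 [^] (- (n A2 * s)) \<otimes> \<one>"
  have z: "central G ?z" by (intro central_mult central_int_pow c_central central_one)
  have "g B2 [^] s \<otimes> g B1 [^] n B1 = g B1 [^] n B1 \<otimes> g B2 [^] s \<otimes> \<one>"
    using g_commute[of B2 s B1 "n B1"] by (simp add: c_AB g_closed)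
  then have *: "g B2 [^] s \<otimes> ?a = ?a \<otimes> g B2 [^] s \<otimes> ?z"
    by (intro push_mult g_commute) (auto simp: g_closed central_int_pow c_central central_mult central_one)
  have "g B2 [^] s \<otimes> generator_part n = (g B2 [^] s \<otimes> ?a) \<otimes> g B2 [^] n B2"
    by (simp add: generator_part_def g_closed m_assoc)
  also have "\<dots> = ?a \<otimes> g B2 [^] s \<otimes> g B2 [^] n B2 \<otimes> ?z"
    unfolding * by (intro central_right z) (auto simp: g_closed)
  finally show ?thesis
    unfolding B2
    by (simp add: generator_part_def commutator_part_def unit_vec_def g_closed c_closed int_pow_mult
        m_assoc mult.commute)
qed

text \<open>\<open>V\<close> is any evaluation of words at \<open>g\<close>, given by its recursion;
  it is later instantiated with \<open>pres_class\<close>.\<close>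

lemma word_value_normal_form:
  assumes "V [] = \<one>" "\<And>h e w. V ((h, e) # w) = g h [^] letter_sign e \<otimes> V w"
  shows "V w = generator_part (expo w) \<otimes> commutator_part (cexpo w)"
proof (induction w)
  case Nil
  show ?case by (simp add: assms generator_part_def commutator_part_def)
next
  case (Cons a w)
  obtain h e where a: "a = (h, e)" by (cases a)
  let ?s = "letter_sign e"
  have "V (a # w) = (g h [^] ?s \<otimes> generator_part (expo w)) \<otimes> commutator_part (cexpo w)"
    by (simp add: a assms(2) Cons g_closed generator_part_closed commutator_part_closed m_assoc)
  also have "\<dots> = generator_part (\<lambda>x. ?s * unit_vec h x + expo w x) \<otimes>
      (commutator_part (\<lambda>i j. - (?s * unit_vec h j * expo w i)) \<otimes> commutator_part (cexpo w))"
    unfolding generator_part_step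
    by (simp add: generator_part_closed commutator_part_closed m_assoc)
  also have "(\<lambda>x. ?s * unit_vec h x + expo w x) = expo (a # w)"
    by (simp add: a fun_eq_iff)
  also have "commutator_part (\<lambda>i j. - (?s * unit_vec h j * expo w i)) \<otimes> commutator_part (cexpo w)
      = commutator_part (cexpo (a # w))"
    unfolding commutator_part_mult by (simp add: a commutator_part_def)
  finally show ?case .
qed

lemma g_pow_p: "g h [^] int p = commutator_part (power_map (int l) (unit_vec h))"
proof -
  have "commutator (g A1) (g B1 [^] l \<otimes> g B2) = c A1 B1 [^] int l \<otimes> c A1 B2"
    using commutator_int_pow_right[of "g A1" "g B1" "int l"]
    by (subst commutator_mult_right)
      (auto simp: g_closed c_def commutator_central int_pow_int
        intro: central_int_pow[of _ "int l", unfolded int_pow_int])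
  moreover have "commutator (g A2) (g B1 \<otimes> g B2) = c A2 B1 \<otimes> c A2 B2"
    by (subst commutator_mult_right)
      (auto simp: g_closed c_def commutator_central)
  ultimately show ?thesis
    by (cases h)
      (simp_all add: int_pow_int g_A1_pow g_A2_pow g_B1_pow g_B2_pow commutator_part_def
        power_map_def unit_vec_def c_closed flip: c_def)
qed

text \<open>\<open>p\<close>-th powers of generators are central, being products of commutators, so
  \<open>g i [^] p\<close> commutes with \<open>g j\<close>; by bilinearity \<open>c i j\<close> has
  trivial \<open>p\<close>-th power.\<close>

lemma c_pow_p: "c i j [^] int p = \<one>"
proof -
  have "g j [^] (1::int) \<otimes> g i [^] int p = g i [^] int p \<otimes> g j [^] (1::int)"
    unfolding g_pow_p using central_commute[OF commutator_part_central, of "g j"]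
    by (simp add: g_closed)
  then have "g i [^] int p \<otimes> g j [^] (1::int) \<otimes> c i j [^] (- int p) = g i [^] int p \<otimes> g j [^] (1::int)"
    using g_commute[of j 1 i "int p"] by simp
  then have "c i j [^] (- int p) = \<one>"
    by (simp add: g_closed c_closed)
  then show ?thesis
    by (metis c_closed int_pow_neg inv_eq_1_iff int_pow_closed)
qed

lemma c_pow_cong:
  assumes "int p dvd r - s"
  shows "c i j [^] r = c i j [^] s"
proof -
  obtain t where "r = s + int p * t" using assms by (metis dvd_def diff_eq_eq add.commute)
  moreover have "c i j [^] (int p * t) = \<one>"
    using int_pow_pow[OF c_closed, of i j "int p" t] by (simp add: c_pow_p)
  ultimately show ?thesis by (simp add: int_pow_mult c_closed)
qed

lemma generator_part_add_p:
  "generator_part (\<lambda>x. n x + int p * k x) =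
    generator_part n \<otimes> commutator_part (power_map (int l) k)"
proof -
  let ?z = "\<lambda>h. commutator_part (\<lambda>i j. k h * power_map (int l) (unit_vec h) i j)"
  have g: "g h [^] (n h + int p * k h) = g h [^] n h \<otimes> ?z h" for h
    by (simp add: int_pow_mult g_closed flip: int_pow_pow) (simp add: g_pow_p commutator_part_pow)
  have "generator_part (\<lambda>x. n x + int p * k x) =
      generator_part n \<otimes> (?z A1 \<otimes> ?z A2 \<otimes> ?z B1 \<otimes> ?z B2)"
    unfolding generator_part_def g
    by (intro central_pull4) (auto simp: g_closed commutator_part_central)
  also have "?z A1 \<otimes> ?z A2 \<otimes> ?z B1 \<otimes> ?z B2 = commutator_part (power_map (int l) k)"
    unfolding commutator_part_mult
    by (rule arg_cong[of _ _ commutator_part]) (auto simp: fun_eq_iff power_map_def unit_vec_def)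
  finally show ?thesis .
qed

text \<open>The multiples of \<open>p\<close> in the exponents turn into central factors by the
  power relations, and exponents of commutators matter only modulo \<open>p\<close>.\<close>

lemma normal_form_cong:
  assumes "jk_equiv (int p) (int l) n m n' m'"
  shows "generator_part n \<otimes> commutator_part m = generator_part n' \<otimes> commutator_part m'"
proof -
  obtain k where k: "\<And>x. n' x = n x + int p * k x"
    "\<And>i j. i \<in> {A1, A2} \<Longrightarrow> j \<in> {B1, B2} \<Longrightarrow> int p dvd m' i j - m i j + power_map (int l) k i j"
    using assms by (rule jk_equivE) blast
  have "generator_part n' \<otimes> commutator_part m' =
      generator_part n \<otimes> commutator_part (\<lambda>i j. power_map (int l) k i j + m' i j)"
    unfolding k(1)[THEN ext, of "\<lambda>x. x"]
    by (simp add: generator_part_add_p m_assoc generator_part_closed commutator_part_closed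
        commutator_part_mult)
  also have "commutator_part (\<lambda>i j. power_map (int l) k i j + m' i j) = commutator_part m"
    unfolding commutator_part_def
    by (intro arg_cong2[where f = "(\<otimes>)"] c_pow_cong)
      (use k(2) in \<open>auto simp: algebra_simps\<close>)
  finally show ?thesis by simp
qed

end

subsection \<open>The word problem\<close>

text \<open>Otherwise the simplifier turns the parameter \<open>(l, 1)\<close> into \<open>(l, Suc 0)\<close>.\<close>

declare One_nat_def [simp del]

lemma pow_word_1 [simp]: "pow_word w 1 = w"
  by (simp add: One_nat_def)

lemma inv_presented_group:
  "inv\<^bsub>presented_group R\<^esub> pres_class R w = pres_class R (inv_word w)"
proof -
  interpret group "presented_group R" by (rule group_presented_group)
  show ?thesis
    by (rule inv_equality)
      (auto simp: mult_presented_group one_presented_group carrier_presented_group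
        pres_class_eq_iff pres_eq_inv_word_left)
qed

lemma nat_pow_presented_group:
  "pres_class R w [^]\<^bsub>presented_group R\<^esub> n = pres_class R (pow_word w n)"
proof -
  interpret group "presented_group R" by (rule group_presented_group)
  show ?thesis
  proof (induction n)
    case (Suc n)
    then show ?case
      by (subst nat_pow_Suc2) (auto simp: carrier_presented_group mult_presented_group)
  qed (simp add: one_presented_group)
qed

lemma commutator_presented_group:
  "group.commutator (presented_group R) (pres_class R u) (pres_class R v) = pres_class R (comm_word u v)"
proof -
  interpret group "presented_group R" by (rule group_presented_group)
  show ?thesis
    by (simp add: commutator_def inv_presented_group mult_presented_group comm_word_def)
qed

lemma pres_class_relation: "(u, v) \<in> R \<Longrightarrow> pres_class R u = pres_class R v"
  using pres_relation[of u v R "[]" "[]"] by (simp add: pres_class_eq_iff)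

lemma jk_relation_simps:
  "(comm_word u v @ w, w @ comm_word u v) \<in> jk_relations p (l, 1)"
  "(pow_word (gen_word A1) p, comm_word (gen_word A1) (gen_word B1)) \<in> jk_relations p (l, 1)"
  "(pow_word (gen_word A2) p, comm_word (gen_word A1) (pow_word (gen_word B1) l @ gen_word B2))
    \<in> jk_relations p (l, 1)"
  "(pow_word (gen_word B1) p, comm_word (gen_word A2) (gen_word B1 @ gen_word B2)) \<in> jk_relations p (l, 1)"
  "(pow_word (gen_word B2) p, comm_word (gen_word A2) (gen_word B2)) \<in> jk_relations p (l, 1)"
  "(comm_word (gen_word A1) (gen_word A2), []) \<in> jk_relations p (l, 1)"
  "(comm_word (gen_word B1) (gen_word B2), []) \<in> jk_relations p (l, 1)"
  unfolding jk_relations_def Let_def by auto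

lemma jk_generated_JK_group:
  "jk_generated (JK_group p (l, 1)) p l (\<lambda>h. pres_class (jk_relations p (l, 1)) (gen_word h))"
proof -
  let ?R = "jk_relations p (l, 1)"
  interpret group "presented_group ?R" by (rule group_presented_group)
  note simps = commutator_presented_group mult_presented_group nat_pow_presented_group one_presented_group
  show ?thesis
    unfolding JK_group_def
  proof unfold_locales
    fix x y assume "x \<in> carrier (presented_group ?R)" "y \<in> carrier (presented_group ?R)"
    then show "central (presented_group ?R) (commutator x y)"
      by (auto simp: central_def carrier_presented_group simps
          pres_class_relation[OF jk_relation_simps(1)])
  next
    fix h show "pres_class ?R (gen_word h) \<in> carrier (presented_group ?R)"
      by (simp add: carrier_presented_group)
  qed (simp_all only: simps pres_class_relation[OF jk_relation_simps(2)]
      pres_class_relation[OF jk_relation_simps(3)] pres_class_relation[OF jk_relation_simps(4)]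
      pres_class_relation[OF jk_relation_simps(5)] pres_class_relation[OF jk_relation_simps(6)]
      pres_class_relation[OF jk_relation_simps(7)])
qed

text \<open>One direction is the invariance of exponents. For the other, both words equal their
  collected forms in the group, and congruent collected forms are equal.\<close>

lemma pres_eq_iff_word_equiv:
  assumes "p > 0"
  shows "pres_eq (jk_relations p (l, 1)) u v \<longleftrightarrow> word_equiv p l u v"
proof
  assume uv: "word_equiv p l u v"
  let ?R = "jk_relations p (l, 1)" and ?G = "JK_group p (l, 1)"
  interpret jk_generated ?G p l "\<lambda>h. pres_class ?R (gen_word h)"
    by (rule jk_generated_JK_group)
  have step: "pres_class ?R ((h, e) # w) = pres_class ?R (gen_word h) [^]\<^bsub>?G\<^esub> letter_sign e \<otimes>\<^bsub>?G\<^esub> pres_class ?R w"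
    for h e w
  proof (cases e)
    case True
    then show ?thesis
      using g_closed[of h] by (simp add: letter_sign_def)
        (simp add: JK_group_def mult_presented_group gen_word_def)
  next
    case False
    then show ?thesis
      using g_closed[of h] by (simp add: int_pow_neg letter_sign_def)
       (simp add: JK_group_def mult_presented_group inv_presented_group gen_word_def)
  qed
  have nf: "pres_class ?R w = generator_part (expo w) \<otimes>\<^bsub>?G\<^esub> commutator_part (cexpo w)" for w
    by (rule word_value_normal_form[where V = "pres_class ?R", OF _ step])
      (simp add: JK_group_def one_presented_group)
  have "pres_class ?R u = pres_class ?R v"
    by (rule trans[OF trans[OF nf normal_form_cong[OF uv[unfolded word_equiv_def]]] nf[symmetric]])
  then show "pres_eq ?R u v" by (simp add: pres_class_eq_iff)
qed (use assms pres_eq_imp_word_equiv in blast)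

subsection \<open>Endomorphisms\<close>

text \<open>Lifts an endomorphism to words, once words for the images of the generators have been
  chosen.\<close>

primrec subst_word :: "(jk_gen \<Rightarrow> jk_gen gword) \<Rightarrow> jk_gen gword \<Rightarrow> jk_gen gword" where
  "subst_word s [] = []"
| "subst_word s (a # w) = (if snd a then s (fst a) else inv_word (s (fst a))) @ subst_word s w"

lemma inv_word_append: "inv_word (u @ v) = inv_word v @ inv_word u"
  by (simp add: inv_word_def)

lemma inv_word_inv_word: "inv_word (inv_word w) = w"
  by (induction w) (auto simp: inv_word_append)

lemma subst_word_append: "subst_word s (u @ v) = subst_word s u @ subst_word s v"
  by (induction u) auto

lemma subst_word_inv_word: "subst_word s (inv_word w) = inv_word (subst_word s w)"
  by (induction w) (auto simp: subst_word_append inv_word_append inv_word_inv_word)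

lemma subst_word_comm_word: "subst_word s (comm_word u v) = comm_word (subst_word s u) (subst_word s v)"
  by (simp add: comm_word_def subst_word_append subst_word_inv_word)

lemma subst_word_pow_word: "subst_word s (pow_word w n) = pow_word (subst_word s w) n"
  by (induction n) (auto simp: subst_word_append)

lemma subst_word_gen_word: "subst_word s (gen_word h) = s h"
  by (simp add: gen_word_def)

lemma hom_eq_subst_word:
  assumes f: "f \<in> hom (presented_group R) (presented_group R)"
    and s: "\<And>h. f (pres_class R (gen_word h)) = pres_class R (s h)"
  shows "f (pres_class R w) = pres_class R (subst_word s w)"
proof -
  interpret group "presented_group R" by (rule group_presented_group)
  interpret group_hom "presented_group R" "presented_group R" f
    using f by unfold_locales
  show ?thesis
  proof (induction w)
    case Nil
    then show ?case using hom_one by (simp add: one_presented_group)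
  next
    case (Cons a w)
    obtain h e where a: "a = (h, e)" by (cases a)
    have inv: "f (pres_class R [(h, False)]) = pres_class R (inv_word (s h))"
      using hom_inv[of "pres_class R (gen_word h)"]
      by (simp add: s inv_presented_group carrier_presented_group) (simp add: gen_word_def)
    have "f (pres_class R ([a] @ w)) = f (pres_class R [a]) \<otimes>\<^bsub>presented_group R\<^esub> f (pres_class R w)"
      unfolding mult_presented_group[symmetric] by (rule hom_mult) (auto simp: carrier_presented_group)
    also have "f (pres_class R [a]) = pres_class R (if e then s h else inv_word (s h))"
      using inv s[of h] by (simp add: a gen_word_def)
    finally show ?case
      by (simp add: Cons mult_presented_group a)
  qed
qed

section \<open>From endomorphisms to compatible families of vectors\<close>

lemma word_equiv_power_relation:
  assumes "word_equiv p l (pow_word u p) (comm_word v w)" "p > 0"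
  shows "tensor_zero (int p)
    (\<lambda>i j. power_form (int l) (int (p choose 2)) (expo u) i j - wedge (expo v) (expo w) i j)"
proof -
  obtain k where k: "\<And>x. expo (comm_word v w) x = expo (pow_word u p) x + int p * k x"
    "\<And>i j. i \<in> {A1, A2} \<Longrightarrow> j \<in> {B1, B2} \<Longrightarrow>
      int p dvd cexpo (comm_word v w) i j - cexpo (pow_word u p) i j + power_map (int l) k i j"
    using assms(1) unfolding word_equiv_def by (rule jk_equivE) blast
  \<comment> \<open>A commutator has zero exponents, so the whole exponent vector of the power has
    to be traded; this determines \<open>k\<close>.\<close>
  have "k x = - expo u x" for x
  proof -
    have "int p * (k x + expo u x) = 0"
      using k(1)[of x] by (simp add: expo_comm_word expo_pow_word algebra_simps)
    then show ?thesis using assms(2) by simp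
  qed
  then have k': "k = (\<lambda>x. - expo u x)" by auto
  show ?thesis
    unfolding tensor_zero_def
  proof (intro ballI)
    fix i j assume ij: "i \<in> {A1, A2}" "j \<in> {B1, B2}"
    then have "i \<noteq> j" by auto
    have "power_map (int l) k i j = - power_map (int l) (expo u) i j"
      by (simp add: k' power_map_def)
    with k(2)[OF ij] show "int p dvd
      power_form (int l) (int (p choose 2)) (expo u) i j - wedge (expo v) (expo w) i j"
      unfolding cexpo_comm_word[OF \<open>i \<noteq> j\<close>] cexpo_pow_word power_form_def wedge_def by algebra
  qed
qed

lemma word_equiv_commutator_relation:
  assumes "word_equiv p l (comm_word v w) []" "p > 0"
  shows "tensor_zero (int p) (wedge (expo v) (expo w))"
proof -
  obtain k where k: "\<And>x. expo [] x = expo (comm_word v w) x + int p * k x"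
    "\<And>i j. i \<in> {A1, A2} \<Longrightarrow> j \<in> {B1, B2} \<Longrightarrow>
      int p dvd cexpo [] i j - cexpo (comm_word v w) i j + power_map (int l) k i j"
    using assms(1) unfolding word_equiv_def by (rule jk_equivE) blast
  have "k x = 0" for x
    using k(1)[of x] assms(2) by (simp add: expo_comm_word)
  then have k': "k = (\<lambda>x. 0)" by auto
  show ?thesis
    unfolding tensor_zero_def
  proof (intro ballI)
    fix i j assume ij: "i \<in> {A1, A2}" "j \<in> {B1, B2}"
    then have "i \<noteq> j" by auto
    have "power_map (int l) k i j = 0" by (simp add: k' power_map_def)
    with k(2)[OF ij] show "int p dvd wedge (expo v) (expo w) i j"
      unfolding cexpo_comm_word[OF \<open>i \<noteq> j\<close>] cexpo.simps wedge_def by algebra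
  qed
qed

text \<open>The induced map on \<open>G/G'\<close> is 0 or the identity.\<close>

definition scalar_mod :: "int \<Rightarrow> (jk_gen \<Rightarrow> jk_gen \<Rightarrow> int) \<Rightarrow> bool" where
  "scalar_mod p f \<longleftrightarrow> (\<exists>e\<in>{0, 1}. \<forall>h x. p dvd f h x - e * unit_vec h x)"

lemma jk_compatible_endomorphism:
  assumes p: "p > 0"
    and f: "f \<in> hom (JK_group p (l, 1)) (JK_group p (l, 1))"
    and s: "\<And>h. f (pres_class (jk_relations p (l, 1)) (gen_word h)) =
      pres_class (jk_relations p (l, 1)) (s h)"
  shows "jk_compatible (int p) (int l) (int (p choose 2)) (\<lambda>h. expo (s h))"
proof -
  let ?R = "jk_relations p (l, 1)"
  have "word_equiv p l (subst_word s u) (subst_word s v)" if "(u, v) \<in> ?R" for u v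
  proof -
    have "pres_class ?R (subst_word s u) = pres_class ?R (subst_word s v)"
      using hom_eq_subst_word[OF f[unfolded JK_group_def] s] pres_class_relation[OF that] by metis
    then show ?thesis
      using pres_eq_iff_word_equiv[OF p] by (simp add: pres_class_eq_iff)
  qed
  \<comment> \<open>The centrality relations are left out; the other six become the six clauses of
    \<open>jk_compatible\<close>.\<close>
  note rel = jk_relation_simps(2-)[THEN this, unfolded subst_word_comm_word subst_word_pow_word
      subst_word_gen_word subst_word_append subst_word.simps(1)]
  have "wedge (expo v) (expo (pow_word w l @ w')) i j =
      int l * wedge (expo v) (expo w) i j + wedge (expo v) (expo w') i j"
    "wedge (expo v) (expo (w @ w')) i j =
      wedge (expo v) (expo w) i j + wedge (expo v) (expo w') i j" for v w w' i j
    by (simp_all add: wedge_def expo_append expo_pow_word algebra_simps)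
  then show ?thesis
    unfolding jk_compatible_def
    using word_equiv_power_relation[OF rel(1) p] word_equiv_power_relation[OF rel(2) p]
      word_equiv_power_relation[OF rel(3) p] word_equiv_power_relation[OF rel(4) p]
      word_equiv_commutator_relation[OF rel(5) p] word_equiv_commutator_relation[OF rel(6) p]
    by simp
qed

text \<open>For odd \<open>p\<close> the prime divides \<open>p choose 2\<close>, so the quadratic
  term of the power map vanishes.\<close>

lemma scalar_mod_odd:
  assumes p: "prime p" "p \<ge> 3"
    and f: "jk_compatible (int p) (int l) (int (p choose 2)) f"
  shows "scalar_mod (int p) f"
proof -
  have "p dvd p choose 2" using p by (intro dvd_choose_prime) auto
  then have "int p dvd int (p choose 2)" by simp
  have "int p dvd power_form (int l) (int (p choose 2)) v i j - t \<longleftrightarrow>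
      int p dvd power_form (int l) 0 v i j - t" for v i j t
  proof -
    have "int p dvd int (p choose 2) * v i * v j"
      using \<open>int p dvd int (p choose 2)\<close> by (simp only: dvd_mult2)
    moreover have "power_form (int l) 0 v i j - t =
      (power_form (int l) (int (p choose 2)) v i j - t) + int (p choose 2) * v i * v j"
      by (simp add: power_form_def)
    ultimately show ?thesis
      by (metis dvd_add_left_iff)
  qed
  then have "jk_compatible (int p) (int l) 0 f"
    using f unfolding jk_compatible_def tensor_zero_def by simp
  then have "(\<forall>g. vec_zero (int p) (f g)) \<or> (\<forall>g x. int p dvd f g x - unit_vec g x)"
    using p by (intro jk_compatible_odd) auto
  then show ?thesis
    unfolding scalar_mod_def vec_zero_def by auto
qed

lemma scalar_mod_two:
  assumes "jk_compatible (int 2) (int 0) (int (2 choose 2)) f"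
  shows "scalar_mod (int 2) f"
  using jk_compatible_two[of f] assms unfolding scalar_mod_def vec_zero_def by auto

section \<open>Action of endomorphisms on exponents\<close>

definition linear_map :: "(jk_gen \<Rightarrow> jk_gen \<Rightarrow> jk_gen \<Rightarrow> int) \<Rightarrow> (jk_gen \<Rightarrow> int) \<Rightarrow>
    jk_gen \<Rightarrow> jk_gen \<Rightarrow> int" where
  "linear_map Z n i j = Z A1 i j * n A1 + Z A2 i j * n A2 + Z B1 i j * n B1 + Z B2 i j * n B2"

lemma jk_equiv_cong:
  assumes "\<And>x. n x = n1 x" "\<And>x. n' x = n1' x"
    and "\<And>i j. i \<in> {A1, A2} \<Longrightarrow> j \<in> {B1, B2} \<Longrightarrow> m i j = m1 i j"
    and "\<And>i j. i \<in> {A1, A2} \<Longrightarrow> j \<in> {B1, B2} \<Longrightarrow> m' i j = m1' i j"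
  shows "jk_equiv p l n m n' m' \<longleftrightarrow> jk_equiv p l n1 m1 n1' m1'"
  using assms unfolding jk_equiv_def by simp

text \<open>An endomorphism acts on exponent pairs by \<open>(n, m)\<close> to
  \<open>(e n, e m + Z n)\<close>. Commutators are in fact scaled by \<open>e * e\<close>, which
  equals \<open>e\<close> for the two admissible values.\<close>

lemma jk_equiv_subst_word:
  assumes e: "e \<in> {0, 1}"
    and s: "\<And>h. jk_equiv p l (\<lambda>x. e * unit_vec h x) (Z h) (expo (s h)) (cexpo (s h))"
  shows "jk_equiv p l (\<lambda>x. e * expo w x) (\<lambda>i j. e * cexpo w i j + linear_map Z (expo w) i j)
    (expo (subst_word s w)) (cexpo (subst_word s w))"
proof (induction w)
  case Nil
  show ?case
    by (rule jk_equiv_cong[THEN iffD1, OF _ _ _ _ jk_equiv_refl[of p l "\<lambda>_. 0" "\<lambda>_ _. 0"]])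
      (auto simp: linear_map_def)
next
  case (Cons a w)
  obtain h b where a: "a = (h, b)" by (cases a)
  let ?u = "if b then s h else inv_word (s h)" and ?s = "letter_sign b"
  have "jk_equiv p l (\<lambda>x. e * ?s * unit_vec h x) (\<lambda>i j. ?s * Z h i j) (expo ?u) (cexpo ?u)"
  proof (cases b)
    case True
    then show ?thesis using s[of h] by (simp add: letter_sign_def)
  next
    case False
    show ?thesis
      by (rule jk_equiv_cong[THEN iffD1, OF _ _ _ _ jk_equiv_inv[OF s[of h]]])
        (auto simp: False letter_sign_def unit_vec_def expo_inv_word cexpo_inv_word)
  qed
  note jk_equiv_mult[OF this Cons.IH]
  moreover have "linear_map Z (\<lambda>x. ?s * unit_vec h x + expo w x) i j = ?s * Z h i j + linear_map Z (expo w) i j" for i j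
    by (cases h) (auto simp: linear_map_def unit_vec_def algebra_simps)
  ultimately show ?case
    using e by (elim jk_equiv_cong[THEN iffD1, rotated -1])
      (auto simp: a expo_append cexpo_append algebra_simps)
qed

lemma jk_equiv_linear_map:
  assumes "jk_equiv p l n m n' m'"
  shows "jk_equiv p l (\<lambda>x. e * n x) (\<lambda>i j. e * m i j + linear_map Z n i j)
    (\<lambda>x. e * n' x) (\<lambda>i j. e * m' i j + linear_map Z n' i j)"
proof -
  obtain k where k: "\<And>x. n' x = n x + p * k x"
    "\<And>i j. i \<in> {A1, A2} \<Longrightarrow> j \<in> {B1, B2} \<Longrightarrow> p dvd m' i j - m i j + power_map l k i j"
    using assms by (rule jk_equivE) blast
  show ?thesis
  proof (rule jk_equivI[where k = "\<lambda>x. e * k x"])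
    fix i j assume ij: "i \<in> {A1, A2}" "j \<in> {B1, B2}"
    have "e * m' i j + linear_map Z n' i j - (e * m i j + linear_map Z n i j)
          + power_map l (\<lambda>x. e * k x) i j
        = e * (m' i j - m i j + power_map l k i j) + p * linear_map Z k i j"
      by (simp add: power_map_def linear_map_def k(1) algebra_simps)
    then show "p dvd e * m' i j + linear_map Z n' i j - (e * m i j + linear_map Z n i j)
          + power_map l (\<lambda>x. e * k x) i j"
      using k(2)[OF ij] by (simp only: dvd_add dvd_triv_left dvd_mult)
  qed (simp add: k(1) algebra_simps)
qed

lemma scalar_mod_imp_linear:
  assumes "scalar_mod p (\<lambda>h. expo (s h))"
  obtains e Z where "e \<in> {0, 1}"
    "\<And>h. jk_equiv p l (\<lambda>x. e * unit_vec h x) (Z h) (expo (s h)) (cexpo (s h))"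
proof -
  obtain e where e: "e \<in> {0, 1}" "\<And>h x. p dvd expo (s h) x - e * unit_vec h x"
    using assms unfolding scalar_mod_def by blast
  then obtain k where k: "\<And>h x. expo (s h) x - e * unit_vec h x = p * k h x"
    unfolding dvd_def by metis
  show ?thesis
  \<comment> \<open>\<open>Z h\<close> contains, besides the commutator exponents of
    \<open>s h\<close>, the central elements obtained for the multiples of \<open>p\<close> dropped
    from its exponents.\<close>
  proof (rule that[OF e(1), of "\<lambda>h i j. cexpo (s h) i j + power_map l (k h) i j"])
    fix h
    show "jk_equiv p l (\<lambda>x. e * unit_vec h x) (\<lambda>i j. cexpo (s h) i j + power_map l (k h) i j)
        (expo (s h)) (cexpo (s h))"
      by (rule jk_equivI[where k = "k h"]) (use k[of h] in \<open>auto simp: algebra_simps\<close>)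
  qed
qed

lemma endomorphisms_commute:
  assumes p: "p > 0"
    and scalar: "\<And>f. jk_compatible (int p) (int l) (int (p choose 2)) f \<Longrightarrow> scalar_mod (int p) f"
    and f: "f \<in> hom (JK_group p (l, 1)) (JK_group p (l, 1))"
    and g: "g \<in> hom (JK_group p (l, 1)) (JK_group p (l, 1))"
    and x: "x \<in> carrier (JK_group p (l, 1))"
  shows "f (g x) = g (f x)"
proof -
  let ?R = "jk_relations p (l, 1)"
  have lift: "\<exists>s. \<forall>h. f' (pres_class ?R (gen_word h)) = pres_class ?R (s h)"
    if "f' \<in> hom (JK_group p (l, 1)) (JK_group p (l, 1))" for f'
  proof -
    have "f' (pres_class ?R (gen_word h)) \<in> range (pres_class ?R)" for h
      using that by (auto simp: hom_def JK_group_def carrier_presented_group)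
    then have "\<forall>h. \<exists>w. f' (pres_class ?R (gen_word h)) = pres_class ?R w" by blast
    then show ?thesis by (rule choice)
  qed
  obtain s where s: "\<And>h. f (pres_class ?R (gen_word h)) = pres_class ?R (s h)"
    using lift[OF f] by blast
  obtain t where t: "\<And>h. g (pres_class ?R (gen_word h)) = pres_class ?R (t h)"
    using lift[OF g] by blast
  obtain e Z where e: "e \<in> {0, 1}"
    and Z: "\<And>h. jk_equiv (int p) (int l) (\<lambda>x. e * unit_vec h x) (Z h) (expo (s h)) (cexpo (s h))"
    by (rule scalar_mod_imp_linear[OF scalar[OF jk_compatible_endomorphism[OF p f s]]]) blast
  obtain e' Z' where e': "e' \<in> {0, 1}"
    and Z': "\<And>h. jk_equiv (int p) (int l) (\<lambda>x. e' * unit_vec h x) (Z' h) (expo (t h)) (cexpo (t h))"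
    by (rule scalar_mod_imp_linear[OF scalar[OF jk_compatible_endomorphism[OF p g t]]]) blast
  obtain w where w: "x = pres_class ?R w"
    using x by (auto simp: JK_group_def carrier_presented_group)
  \<comment> \<open>The common value of both composites: \<open>e (e' m + Z' n) + Z (e' n)\<close>
    is symmetric under exchanging \<open>(e, Z)\<close> and \<open>(e', Z')\<close>.\<close>
  let ?n = "\<lambda>x. e * e' * expo w x"
    and ?m = "\<lambda>i j. e * e' * cexpo w i j + e * linear_map Z' (expo w) i j + e' * linear_map Z (expo w) i j"
  have "jk_equiv (int p) (int l) ?n ?m
      (expo (subst_word s (subst_word t w))) (cexpo (subst_word s (subst_word t w)))"
  proof (rule jk_equiv_trans[OF _ jk_equiv_subst_word[OF e Z]])
    show "jk_equiv (int p) (int l) ?n ?m (\<lambda>x. e * expo (subst_word t w) x)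
      (\<lambda>i j. e * cexpo (subst_word t w) i j + linear_map Z (expo (subst_word t w)) i j)"
      by (rule jk_equiv_cong[THEN iffD1, OF _ _ _ _
            jk_equiv_linear_map[OF jk_equiv_subst_word[OF e' Z']]])
        (auto simp: linear_map_def algebra_simps)
  qed
  moreover have "jk_equiv (int p) (int l) ?n ?m
      (expo (subst_word t (subst_word s w))) (cexpo (subst_word t (subst_word s w)))"
  proof (rule jk_equiv_trans[OF _ jk_equiv_subst_word[OF e' Z']])
    show "jk_equiv (int p) (int l) ?n ?m (\<lambda>x. e' * expo (subst_word s w) x)
      (\<lambda>i j. e' * cexpo (subst_word s w) i j + linear_map Z' (expo (subst_word s w)) i j)"
      by (rule jk_equiv_cong[THEN iffD1, OF _ _ _ _
            jk_equiv_linear_map[OF jk_equiv_subst_word[OF e Z]]])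
        (auto simp: linear_map_def algebra_simps)
  qed
  ultimately have "word_equiv p l (subst_word s (subst_word t w)) (subst_word t (subst_word s w))"
    unfolding word_equiv_def by (blast intro: jk_equiv_trans jk_equiv_sym)
  then have "pres_class ?R (subst_word s (subst_word t w)) = pres_class ?R (subst_word t (subst_word s w))"
    by (simp only: pres_class_eq_iff pres_eq_iff_word_equiv[OF p])
  then show ?thesis
    by (simp add: w hom_eq_subst_word[OF f[unfolded JK_group_def] s]
        hom_eq_subst_word[OF g[unfolded JK_group_def] t])
qed

lemma comm_monoid_End_monoid:
  assumes "group G"
    and commute: "\<And>f g x. f \<in> hom G G \<Longrightarrow> g \<in> hom G G \<Longrightarrow> x \<in> carrier G \<Longrightarrow> f (g x) = g (f x)"
  shows "comm_monoid (End_monoid G)"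
proof -
  interpret group G by fact
  have closed: "f x \<in> carrier G" if "f \<in> hom G G" "x \<in> carrier G" for f x
    using that by (auto simp: hom_def)
  have compose: "compose (carrier G) f g \<in> hom G G" if "f \<in> hom G G" "g \<in> hom G G" for f g
    using that by (auto simp: hom_def compose_def Pi_iff)
  show ?thesis
  proof (rule comm_monoidI)
    fix f g assume "f \<in> carrier (End_monoid G)" "g \<in> carrier (End_monoid G)"
    then show "f \<otimes>\<^bsub>End_monoid G\<^esub> g \<in> carrier (End_monoid G)"
      by (auto simp: End_monoid_def compose)
    show "f \<otimes>\<^bsub>End_monoid G\<^esub> g = g \<otimes>\<^bsub>End_monoid G\<^esub> f"
      using \<open>f \<in> _\<close> \<open>g \<in> _\<close> commute by (auto simp: End_monoid_def compose_def fun_eq_iff)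
  next
    fix f g h assume "f \<in> carrier (End_monoid G)" "g \<in> carrier (End_monoid G)" "h \<in> carrier (End_monoid G)"
    then show "f \<otimes>\<^bsub>End_monoid G\<^esub> g \<otimes>\<^bsub>End_monoid G\<^esub> h = f \<otimes>\<^bsub>End_monoid G\<^esub> (g \<otimes>\<^bsub>End_monoid G\<^esub> h)"
      by (auto simp: End_monoid_def compose_def fun_eq_iff closed)
  next
    fix f assume "f \<in> carrier (End_monoid G)"
    then show "\<one>\<^bsub>End_monoid G\<^esub> \<otimes>\<^bsub>End_monoid G\<^esub> f = f"
      by (auto simp: End_monoid_def compose_def fun_eq_iff closed extensional_def)
  qed (auto simp: End_monoid_def hom_def)
qed

lemma group_JK_group: "group (JK_group p l)"
  by (simp add: JK_group_def group_presented_group)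

lemma comm_monoid_End_JK_group:
  assumes "p > 0"
    and "\<And>f. jk_compatible (int p) (int l) (int (p choose 2)) f \<Longrightarrow> scalar_mod (int p) f"
  shows "comm_monoid (End_monoid (JK_group p (l, 1)))"
  using assms by (intro comm_monoid_End_monoid group_JK_group endomorphisms_commute)

text \<open>The two products of \<open>A1\<close> and \<open>B1\<close> have equal exponents, which
  forces \<open>k = 0\<close>, but their exponents of \<open>[A1, B1]\<close> differ by one.\<close>

lemma JK_group_noncommutative:
  assumes "p \<ge> 2"
  shows "\<not> comm_group (JK_group p (l, 1))"
proof
  let ?R = "jk_relations p (l, 1)"
  assume "comm_group (JK_group p (l, 1))"
  then interpret comm_group "JK_group p (l, 1)" .
  have "pres_class ?R (gen_word A1 @ gen_word B1) = pres_class ?R (gen_word B1 @ gen_word A1)"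
    using m_comm[of "pres_class ?R (gen_word A1)" "pres_class ?R (gen_word B1)"]
    by (simp add: JK_group_def carrier_presented_group mult_presented_group)
  then have "word_equiv p l (gen_word A1 @ gen_word B1) (gen_word B1 @ gen_word A1)"
    using assms pres_eq_iff_word_equiv[of p l] by (simp add: pres_class_eq_iff)
  then obtain k where k:
    "\<And>x. expo (gen_word B1 @ gen_word A1) x = expo (gen_word A1 @ gen_word B1) x + int p * k x"
    "\<And>i j. i \<in> {A1, A2} \<Longrightarrow> j \<in> {B1, B2} \<Longrightarrow> int p dvd
      cexpo (gen_word B1 @ gen_word A1) i j - cexpo (gen_word A1 @ gen_word B1) i j + power_map (int l) k i j"
    unfolding word_equiv_def by (rule jk_equivE) blast
  have "k x = 0" for x using k(1)[of x] assms by (simp add: expo_append)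
  then have "int p dvd 1"
    using k(2)[of A1 B1] by (simp add: power_map_def cexpo_append expo_gen_word unit_vec_def)
  then show False using assms by simp
qed

subsection \<open>The order of the JK-group\<close>

text \<open>A canonical representative of the congruence class: quotients of the exponents by
  \<open>p\<close> are carried into the commutator part through \<open>power_map\<close>.
  Restricting to the four meaningful index pairs makes congruence an equality of functions.\<close>

definition reduced_form :: "nat \<Rightarrow> nat \<Rightarrow> jk_gen gword \<Rightarrow> (jk_gen \<Rightarrow> int) \<times> (jk_gen \<times> jk_gen \<Rightarrow> int)" where
  "reduced_form p l w =
    (\<lambda>x. expo w x mod int p,
     \<lambda>(i, j)\<in>{A1, A2} \<times> {B1, B2}.
       (cexpo w i j + power_map (int l) (\<lambda>x. expo w x div int p) i j) mod int p)"

lemma word_equiv_iff_reduced_form: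
  assumes "p > 0"
  shows "word_equiv p l u v \<longleftrightarrow> reduced_form p l u = reduced_form p l v"
proof
  assume "word_equiv p l u v"
  then obtain k where k: "\<And>x. expo v x = expo u x + int p * k x"
    "\<And>i j. i \<in> {A1, A2} \<Longrightarrow> j \<in> {B1, B2} \<Longrightarrow>
      int p dvd cexpo v i j - cexpo u i j + power_map (int l) k i j"
    unfolding word_equiv_def by (rule jk_equivE) blast
  have "(cexpo u i j + power_map (int l) (\<lambda>x. expo u x div int p) i j) mod int p =
      (cexpo v i j + power_map (int l) (\<lambda>x. expo v x div int p) i j) mod int p"
    if ij: "i \<in> {A1, A2}" "j \<in> {B1, B2}" for i j
  proof -
    have "power_map (int l) (\<lambda>x. expo v x div int p) i j =
      power_map (int l) (\<lambda>x. expo u x div int p) i j + power_map (int l) k i j"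
      using assms by (simp add: k(1) power_map_def algebra_simps)
    then show ?thesis
      using k(2)[OF ij] by (simp add: mod_eq_dvd_iff dvd_diff_commute algebra_simps)
  qed
  then show "reduced_form p l u = reduced_form p l v"
    by (auto simp: reduced_form_def k(1) fun_eq_iff)
next
  assume eq: "reduced_form p l u = reduced_form p l v"
  show "word_equiv p l u v"
    unfolding word_equiv_def
  proof (rule jk_equivI[where k = "\<lambda>x. expo v x div int p - expo u x div int p"])
    fix x
    have "expo u x mod int p = expo v x mod int p"
      using eq by (auto simp: reduced_form_def fun_eq_iff)
    then show "expo v x = expo u x + int p * (expo v x div int p - expo u x div int p)"
      using mult_div_mod_eq[of "int p" "expo u x"] mult_div_mod_eq[of "int p" "expo v x"]
      unfolding right_diff_distrib by linarith
  next
    fix i j assume ij: "i \<in> {A1, A2}" "j \<in> {B1, B2}"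
    have "(cexpo u i j + power_map (int l) (\<lambda>x. expo u x div int p) i j) mod int p =
      (cexpo v i j + power_map (int l) (\<lambda>x. expo v x div int p) i j) mod int p"
      using eq ij by (auto simp: reduced_form_def restrict_def fun_eq_iff split: if_splits)
    then have "int p dvd (cexpo v i j + power_map (int l) (\<lambda>x. expo v x div int p) i j)
      - (cexpo u i j + power_map (int l) (\<lambda>x. expo u x div int p) i j)"
      by (metis mod_eq_dvd_iff)
    then show "int p dvd cexpo v i j - cexpo u i j
        + power_map (int l) (\<lambda>x. expo v x div int p - expo u x div int p) i j"
      by (auto simp: power_map_def algebra_simps)
  qed
qed

lemma range_reduced_form:
  assumes "p > 0"
  shows "range (reduced_form p l) =
    (UNIV \<rightarrow>\<^sub>E {0..<int p}) \<times> ({A1, A2} \<times> {B1, B2} \<rightarrow>\<^sub>E {0..<int p})" (is "_ = ?S")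
proof
  show "range (reduced_form p l) \<subseteq> ?S"
    using assms unfolding reduced_form_def
    by (intro image_subsetI SigmaI) (auto simp: restrict_PiE_iff simp del: restrict_apply)
  show "?S \<subseteq> range (reduced_form p l)"
  proof
    fix nm assume S: "nm \<in> ?S"
    obtain n m where nm: "nm = (n, m)" by (cases nm)
    have n: "n x \<in> {0..<int p}" for x
      using S unfolding nm mem_Times_iff fst_conv by (elim conjE PiE_mem) simp
    have m: "m \<in> {A1, A2} \<times> {B1, B2} \<rightarrow>\<^sub>E {0..<int p}"
      using S unfolding nm mem_Times_iff snd_conv by (elim conjE)
    let ?g = "\<lambda>h. pow_word (gen_word h) (nat (n h))"
      and ?c = "\<lambda>i j. pow_word (comm_word (gen_word i) (gen_word j)) (nat (m (i, j)))"
    \<comment> \<open>The word is already collected, so no crossings disturb the prescribed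
      exponents.\<close>
    define w where "w = ?g A1 @ ?g A2 @ ?g B1 @ ?g B2 @ ?c A1 B1 @ ?c A1 B2 @ ?c A2 B1 @ ?c A2 B2"
    have expo: "expo w x = n x" for x
      using n[of x]
      by (cases x) (auto simp: w_def expo_append expo_pow_word expo_gen_word expo_comm_word unit_vec_def)
    have m': "0 \<le> m (i, j) \<and> m (i, j) < int p" if "i \<in> {A1, A2}" "j \<in> {B1, B2}" for i j
      using m that by (auto simp: PiE_iff)
    have cexpo: "cexpo w i j = m (i, j)" if "i \<in> {A1, A2}" "j \<in> {B1, B2}" for i j
      using that m'[OF that]
      by (auto simp: w_def cexpo_append expo_append cexpo_pow_word expo_pow_word expo_gen_word
          expo_comm_word cexpo_comm_word unit_vec_def)
    have "reduced_form p l w = (n, m)"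
    proof -
      have "n x mod int p = n x" "n x div int p = 0" for x
        using n[of x] by auto
      moreover have "(\<lambda>(i, j)\<in>{A1, A2} \<times> {B1, B2}. cexpo w i j mod int p) = m"
        using m m' by (intro extensionalityI[of _ "{A1, A2} \<times> {B1, B2}"]) (auto simp: cexpo PiE_iff)
      ultimately show ?thesis
        by (simp add: reduced_form_def expo power_map_zero)
    qed
    then show "nm \<in> range (reduced_form p l)" by (metis nm rangeI)
  qed
qed

lemma UNIV_jk_gen: "(UNIV :: jk_gen set) = {A1, A2, B1, B2}"
  using jk_gen.exhaust by auto

text \<open>Elements correspond to reduced forms: four residues for \<open>G/G'\<close> and four for
  \<open>G'\<close>.\<close>

lemma order_JK_group:
  assumes "p > 0"
  shows "order (JK_group p (l, 1)) = p ^ 8"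
proof -
  let ?R = "jk_relations p (l, 1)"
  have iff: "pres_class ?R u = pres_class ?R v \<longleftrightarrow> reduced_form p l u = reduced_form p l v" for u v
    by (simp only: pres_class_eq_iff pres_eq_iff_word_equiv[OF assms] word_equiv_iff_reduced_form[OF assms])
  define F where "F X = reduced_form p l (inv_into UNIV (pres_class ?R) X)" for X
  have F: "F (pres_class ?R w) = reduced_form p l w" for w
    unfolding F_def by (simp add: f_inv_into_f flip: iff)
  have "bij_betw F (range (pres_class ?R)) (range (reduced_form p l))"
    unfolding bij_betw_def inj_on_def by (auto simp: F iff image_iff)
  then have "order (JK_group p (l, 1)) = card (range (reduced_form p l))"
    by (simp add: order_def JK_group_def carrier_presented_group bij_betw_same_card)
  also have "\<dots> = p ^ 4 * p ^ 4"
  proof -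
    have "card (UNIV \<rightarrow>\<^sub>E {0..<int p} :: (jk_gen \<Rightarrow> int) set) = p ^ card {A1, A2, B1, B2}"
      unfolding UNIV_jk_gen by (subst card_funcsetE) auto
    moreover have "card ({A1, A2} \<times> {B1, B2} \<rightarrow>\<^sub>E {0..<int p}) = p ^ card ({A1, A2} \<times> {B1, B2})"
      by (subst card_funcsetE) auto
    moreover have "card {A1, A2, B1, B2} = 4" "card ({A1, A2} \<times> {B1, B2}) = 4"
      by simp_all
    ultimately show ?thesis
      by (simp only: range_reduced_form[OF assms] card_cartesian_product[of "PiE _ _"])
  qed
  also have "\<dots> = p ^ 8"
    by (simp flip: power_add)
  finally show ?thesis .
qed

lemma finite_p_group_JK_group:
  assumes "prime p"
  shows "finite_p_group p (JK_group p (l, 1))"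
proof -
  have "order (JK_group p (l, 1)) = p ^ 8"
    using assms by (intro order_JK_group prime_gt_0_nat)
  moreover from this have "finite (carrier (JK_group p (l, 1)))"
    using assms by (intro card_ge_0_finite) (simp add: order_def prime_gt_0_nat)
  ultimately show ?thesis
    unfolding finite_p_group_def using group_JK_group by blast
qed

theorem theorem1:
  shows "(\<forall>p l. prime p \<and> p \<ge> 3 \<and> l \<in> {(i, 1) | i. i < p} \<longrightarrow>
            comm_monoid (End_monoid (JK_group p l))) \<and>
         comm_monoid (End_monoid (JK_group 2 (0, 1))) \<and>
         (\<forall>p::nat. prime p \<longrightarrow>
            (\<exists>G :: jk_gen gword set monoid.
               finite_p_group p G \<and> \<not> comm_group G \<and> comm_monoid (End_monoid G)))"
proof -
  have odd: "comm_monoid (End_monoid (JK_group p (i, 1)))" if "prime p" "p \<ge> 3" for p i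
    using that by (intro comm_monoid_End_JK_group scalar_mod_odd) auto
  have two: "comm_monoid (End_monoid (JK_group 2 (0, 1)))"
    by (intro comm_monoid_End_JK_group scalar_mod_two) auto
  \<comment> \<open>The parameter (0, 1) is covered for every prime, including 2, and so supplies
    the nonabelian examples.\<close>
  have "comm_monoid (End_monoid (JK_group p (0, 1)))" if "prime p" for p
    using odd[OF that] two prime_ge_2_nat[OF that] by (cases "p = 2") auto
  then have "\<exists>G :: jk_gen gword set monoid.
      finite_p_group p G \<and> \<not> comm_group G \<and> comm_monoid (End_monoid G)" if "prime p" for p
    using that finite_p_group_JK_group JK_group_noncommutative prime_ge_2_nat by blast
  with odd two show ?thesis by blast
qed

end
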